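(* Let $X = \varprojlim\langle I,f_i\rangle$ be an arc-like continuum, where each $f_i \colon I \to I$ ($i \in \mathbb{N}$) is a piecewise-linear map, and let $\mathbf{Z} = \{\mathbf{z}_1,\mathbf{z}_2,\ldots\}$ be a countably infinite set of points in $X$. Suppose that for each $i \in \mathbb{N}$: (1) the points $\pi_{i+1}(\mathbf{z}_1),\ldots,\pi_{i+1}(\mathbf{z}_i)$ are all distinct; (2) for each $z,z' \in \pi_{i+1}(\{\mathbf{z}_1,\ldots,\mathbf{z}_i\})$, if $z < z'$ then $f_i(z) < f_i(z')$; and (3) every $\pi_{i+1}(\{\mathbf{z}_1,\ldots,\mathbf{z}_i\})$-visor under $f_i$ is removable. Then there exists an embedding $\Omega \colon X \to \mathbb{R}^2$ such that $\Omega(\mathbf{z})$ is an accessible point of $\Omega(X)$ for each $\mathbf{z} \in \mathbf{Z}$.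
   Context: $I=[0,1]$; a map is a continuous function; a map $f \colon I \to I$ is piecewise-linear if there are $0=c_0<c_1<\cdots<c_n=1$ such that $f$ is linear on each $[c_{i-1},c_i]$. For maps $f_i \colon I \to I$, $\varprojlim\langle I,f_i\rangle = \{\langle x_1,x_2,\ldots\rangle \in \prod_{i\ge 1} I : f_i(x_{i+1}) = x_i \text{ for all } i\ge 1\}$ with the subspace topology from the product, and $\pi_i$ denotes the $i$-th coordinate projection $\pi_i(\langle x_1,x_2,\ldots\rangle)=x_i$. A continuum (compact connected metric space) is arc-like if it is homeomorphic to such an inverse limit. A point $x$ of a continuum $Y \subset \mathbb{R}^2$ is accessible if there is an arc $A \subset \mathbb{R}^2$ with $A \cap Y = \{x\}$. Visors. Let $f \colon I \to I$ be a piecewise-linear map and $Z=\{z_1,\ldots,z_n\}\subset I$ with $z_1<\cdots<z_n$ and $f(z_1)<\cdots<f(z_n)$. A $Z$-visor for $z_j$ under $f$ is a point $v \in I$ such that $v<z_j$, $[v,z_j)\cap Z=\emptyset$, and $f(v)>f(z_j)$. A $Z$-visor under $f$ is a point that is a $Z$-visor for some $z_j$ under $f$. Given $a,b,c\in I$ and a $Z$-visor $v$ for $z_j$ under $f$, the triple $\langle a,b,c\rangle$ removes $v$ if: (i) $a<v<b$ and $z_j<c$; (ii) $(a,b)\cap Z=\emptyset$; (iii) either $a=0$ and $0\notin Z$, or $f(a)\le f(x)$ for all $x\in[a,b]$; (iv) either $c=1$, or $f(c)\ge f(x)$ for all $x\in[a,b]$; and (v) $f(b)\le f(x)$ for all $x\in[b,c]$.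 The visor $v$ is removable if some triple $\langle a,b,c\rangle\in I^3$ removes $v$. *)

theory Defs
  imports "HOL-Analysis.Analysis"
begin

(* Only the values on [0,1] matter: a map of the interval is represented by a total
   function on the reals that is arbitrary outside [0,1]. *)
definition interval_map :: "(real \<Rightarrow> real) \<Rightarrow> bool" where
  "interval_map f \<longleftrightarrow> continuous_on {0..1} f \<and> f ` {0..1} \<subseteq> {0..1}"

(* "Linear" on a subinterval means affine there. *)
definition piecewise_linear_map :: "(real \<Rightarrow> real) \<Rightarrow> bool" where
  "piecewise_linear_map f \<longleftrightarrow>
     interval_map f \<and>
     (\<exists>(n::nat) (c :: nat \<Rightarrow> real).
        c 0 = 0 \<and> c n = 1 \<and> (\<forall>i\<in>{1..n}. c (i - 1) < c i) \<and>
        (\<forall>i\<in>{1..n}. \<exists>m b. \<forall>x\<in>{c (i - 1)..c i}. f x = m * x + b))"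

(* Sequences are indexed from 1; as elements of the library's product space over {1..}
   they are extensional, that is, undefined at index 0. *)
definition inverse_limit :: "(nat \<Rightarrow> real \<Rightarrow> real) \<Rightarrow> (nat \<Rightarrow> real) topology" where
  "inverse_limit f =
     subtopology (product_topology (\<lambda>_. top_of_set {0..1}) {1..})
       {x. \<forall>i\<ge>1. f i (x (i + 1)) = x i}"

definition accessible :: "(real^2) set \<Rightarrow> real^2 \<Rightarrow> bool" where
  "accessible Y x \<longleftrightarrow> x \<in> Y \<and> (\<exists>g. arc g \<and> path_image g \<inter> Y = {x})"

definition visor_for :: "(real \<Rightarrow> real) \<Rightarrow> real set \<Rightarrow> real \<Rightarrow> real \<Rightarrow> bool" where
  "visor_for f Z z v \<longleftrightarrow>
     z \<in> Z \<and> v \<in> {0..1} \<and> v < z \<and> {v..<z} \<inter> Z = {} \<and> f v > f z"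

definition visor :: "(real \<Rightarrow> real) \<Rightarrow> real set \<Rightarrow> real \<Rightarrow> bool" where
  "visor f Z v \<longleftrightarrow> (\<exists>z. visor_for f Z z v)"

definition removes ::
  "(real \<Rightarrow> real) \<Rightarrow> real set \<Rightarrow> real \<Rightarrow> real \<Rightarrow> real \<Rightarrow> real \<Rightarrow> real \<Rightarrow> bool" where
  "removes f Z a b c z v \<longleftrightarrow>
     a < v \<and> v < b \<and> z < c \<and>
     {a<..<b} \<inter> Z = {} \<and>
     ((a = 0 \<and> 0 \<notin> Z) \<or> (\<forall>x\<in>{a..b}. f a \<le> f x)) \<and>
     (c = 1 \<or> (\<forall>x\<in>{a..b}. f c \<ge> f x)) \<and>
     (\<forall>x\<in>{b..c}. f b \<le> f x)"

(* The point z for which v is a visor is unique: it is the least element of Z above v. *)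
definition removable :: "(real \<Rightarrow> real) \<Rightarrow> real set \<Rightarrow> real \<Rightarrow> bool" where
  "removable f Z v \<longleftrightarrow>
     (\<exists>z. visor_for f Z z v \<and>
        (\<exists>a\<in>{0..1}. \<exists>b\<in>{0..1}. \<exists>c\<in>{0..1}. removes f Z a b c z v))"

end

theory Submission
  imports Defs
begin

text \<open>The inverse limit is embedded by drawing the interval of each level in a thin neighbourhood of the
  preceding drawing, so that the drawing of level \<open>i + 1\<close> follows the one of level \<open>i\<close> as prescribed by the
  bonding map \<open>f i\<close>. All drawings are produced by injective continuous maps of the plane, and these
  are arranged so that below each of the first \<open>i\<close> marked points a vertical ray remains free and is no longer
  changed outside a small neighbourhood. In the limit the rays become paths that meet the embedded
  continuum in their end points only (\<open>inverse_limit_embedding\<close>).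

  Everything thus reduces to a single bonding map \<open>f\<close> with a finite marked set \<open>Z\<close> on which \<open>f\<close> is
  strictly increasing. The naive drawing of \<open>f\<close> puts the point of parameter \<open>x\<close> close to \<open>(f x, 0)\<close> with a
  small height proportional to \<open>x\<close>. Then the ray below a marked point \<open>z\<close> is
  free up to a horizontal motion, provided that \<open>f x \<le> f z\<close> for all \<open>x < z\<close>, that is, provided that there
  are no visors. A removing triple \<open>(a, b, c)\<close> allows a different order of heights: the arc over \<open>[a, b]\<close>
  containing the visor is turned upside down and put on top of the arc over \<open>[b, c]\<close>, which contains
  \<open>z\<close> (\<open>layout_flip\<close>). The conditions on \<open>f a\<close>, \<open>f b\<close> and \<open>f c\<close> say that the connections between these pieces
  can pass on the left and on the right of them. The combinatorial heart is that the triples for all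
  visors can be chosen without crossings, only nested or side by side, so that these
  operations combine to a single height function (\<open>layout_exists\<close>).

  Given the heights, the planar map is assembled from a vertical and a horizontal motion
  (\<open>bending_map\<close>). The horizontal one requires to extend a function that is defined on the lifted interval and
  the rays and is isotone on horizontal slices to an isotone continuous function on the
  plane (\<open>isotone_extension\<close>).\<close>

section \<open>Monotone extension\<close>

text \<open>A one-sided distance: moving from \<open>q\<close> to \<open>p\<close> horizontally to the right costs nothing.
  A function that is continuous with respect to \<open>excess\<close> is therefore automatically nondecreasing
  along horizontal lines.\<close>

definition excess :: "real \<times> real \<Rightarrow> real \<times> real \<Rightarrow> real" where
  "excess q p = \<bar>snd q - snd p\<bar> + max 0 (fst q - fst p)"

lemma excess_nonneg: "0 \<le> excess q p" by (simp add: excess_def)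
lemma excess_self: "excess p p = 0" by (simp add: excess_def)
lemma excess_triangle: "excess q p' \<le> excess q p + excess p p'" by (auto simp: excess_def max_def)
lemma continuous_on_excess: "continuous_on S (\<lambda>x. excess (fst x) (snd x))"
  unfolding excess_def by (intro continuous_intros)

text \<open>A McShane-type extension with respect to \<open>excess\<close>. The function \<open>M\<close> below is a
  subadditive modulus that dominates every increment of \<open>u\<close> on \<open>F\<close>; isotony of \<open>u\<close> on
  horizontal slices together with compactness is exactly what makes it tend to 0 at the origin.
  Then \<open>\<Phi> p = sup (u q - M (excess q p))\<close> agrees with \<open>u\<close> on \<open>F\<close>, and both its continuity and its
  isotony follow from the triangle inequality for \<open>excess\<close>.\<close>

lemma isotone_extension:
  fixes F :: "(real \<times> real) set" and u :: "real \<times> real \<Rightarrow> real"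
  assumes cF: "compact F" and cu: "continuous_on F u"
    and iso: "\<And>x x' w. (x, w) \<in> F \<Longrightarrow> (x', w) \<in> F \<Longrightarrow> x \<le> x' \<Longrightarrow> u (x, w) \<le> u (x', w)"
  obtains \<Phi> where "continuous_on UNIV \<Phi>" "\<And>p. p \<in> F \<Longrightarrow> \<Phi> p = u p"
    "\<And>x x' w. x \<le> x' \<Longrightarrow> \<Phi> (x, w) \<le> \<Phi> (x', w)"
proof (cases "F = {}")
  case True
  then show ?thesis by (intro that[of "\<lambda>_. 0"]) auto
next
  case False
  have "bounded (u ` F)"
    using compact_continuous_image[OF cu cF] by (rule compact_imp_bounded)
  then obtain C where C: "\<And>q. q \<in> F \<Longrightarrow> \<bar>u q\<bar> \<le> C" "C > 0"
    unfolding bounded_pos by auto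
  define D where "D = (\<lambda>(q, p). max 0 (u q - u p))"
  \<comment> \<open>If \<open>excess\<close> is 0, then \<open>D\<close> is 0 by isotony, so the junk value of the quotient is harmless.\<close>
  define \<tau> where "\<tau> = (\<lambda>t x. D x * min 1 (t / excess (fst x) (snd x)))"
  define M where "M = (\<lambda>t. SUP x \<in> F \<times> F. \<tau> t x)"
  have D0: "0 \<le> D x" for x by (auto simp: D_def split: prod.split)
  have D2: "x \<in> F \<times> F \<Longrightarrow> D x \<le> 2 * C" for x
    using C by (auto simp: D_def abs_le_iff) (smt (verit, best))
  have \<tau>D: "\<tau> t x \<le> D x" for t x
    unfolding \<tau>_def using D0[of x] by (simp add: mult_left_le)
  have bdd: "bdd_above (\<tau> t ` (F \<times> F))" for t
    by (rule bdd_aboveI2[of _ _ "2 * C"]) (use D2 \<tau>D order_trans in blast)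
  have \<tau>M: "\<tau> t x \<le> M t" if "x \<in> F \<times> F" for t x
    unfolding M_def by (rule cSUP_upper[OF that bdd])
  have Mle: "M t \<le> B" if "\<And>x. x \<in> F \<times> F \<Longrightarrow> \<tau> t x \<le> B" for t B
    unfolding M_def by (rule cSUP_least) (use that False in auto)
  have M0: "M 0 = 0"
  proof (rule antisym)
    show "M 0 \<le> 0" by (rule Mle) (simp add: \<tau>_def)
    obtain q where "q \<in> F" using False by auto
    then show "0 \<le> M 0" using \<tau>M[of "(q,q)" 0] by (simp add: \<tau>_def)
  qed
  have Mmono: "M t \<le> M t'" if "0 \<le> t" "t \<le> t'" for t t'
  proof (rule Mle)
    fix x assume x: "x \<in> F \<times> F"
    have "\<tau> t x \<le> \<tau> t' x" unfolding \<tau>_def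
      by (intro mult_left_mono D0 min.mono divide_right_mono excess_nonneg order_refl that)
    then show "\<tau> t x \<le> M t'" using \<tau>M[OF x, of t'] by simp
  qed
  have Msub: "M (t + t') \<le> M t + M t'" if "0 \<le> t" "0 \<le> t'" for t t'
  proof (rule Mle)
    fix x assume x: "x \<in> F \<times> F"
    let ?e = "excess (fst x) (snd x)"
    have e: "0 \<le> t / ?e" "0 \<le> t' / ?e" using that excess_nonneg by (auto intro!: divide_nonneg_nonneg)
    have "min 1 ((t + t') / ?e) \<le> min 1 (t / ?e) + min 1 (t' / ?e)"
      using e by (auto simp: add_divide_distrib min_def)
    then have "D x * min 1 ((t + t') / ?e) \<le> D x * (min 1 (t / ?e) + min 1 (t' / ?e))"
      by (intro mult_left_mono D0)
    then have "\<tau> (t + t') x \<le> \<tau> t x + \<tau> t' x"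
      by (simp add: \<tau>_def distrib_left)
    then show "\<tau> (t + t') x \<le> M t + M t'"
      using \<tau>M[OF x, of t] \<tau>M[OF x, of t'] by linarith
  qed
  have Mu: "u q - u p \<le> M (excess q p)" if "q \<in> F" "p \<in> F" for q p
  proof (cases "excess q p = 0")
    case True
    then have "snd q = snd p" "fst q \<le> fst p" by (auto simp: excess_def max_def split: if_splits)
    then have "u q \<le> u p" using iso[of "fst q" "snd q" "fst p"] that by (metis prod.collapse)
    then show ?thesis using True M0 by simp
  next
    case False
    then have "\<tau> (excess q p) (q, p) = D (q, p)" by (simp add: \<tau>_def)
    then show ?thesis using \<tau>M[of "(q, p)" "excess q p"] that by (simp add: D_def)
  qed
  have Msmall: "\<exists>d>0. \<forall>t. 0 \<le> t \<and> t < d \<longrightarrow> M t \<le> e" if "e > 0" for e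
  proof -
    define K where "K = {x \<in> F \<times> F. e \<le> u (fst x) - u (snd x)}"
    have cFF: "compact (F \<times> F)" using cF by (rule compact_Times[OF _ cF])
    have cd: "continuous_on (F \<times> F) (\<lambda>x. u (fst x) - u (snd x))"
      by (intro continuous_intros continuous_on_compose2[OF cu]) auto
    have "compact K"
    proof -
      have "closedin (top_of_set (F \<times> F)) ((F \<times> F) \<inter> (\<lambda>x. u (fst x) - u (snd x)) -` {e..})"
        by (rule continuous_closedin_preimage[OF cd]) auto
      moreover have "(F \<times> F) \<inter> (\<lambda>x. u (fst x) - u (snd x)) -` {e..} = K"
        by (auto simp: K_def)
      ultimately show ?thesis using closedin_compact[OF cFF] by auto
    qed
    have "\<exists>d>0. \<forall>x\<in>K. d \<le> excess (fst x) (snd x)"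
    proof (cases "K = {}")
      case True
      then show ?thesis by (intro exI[of _ 1]) auto
    next
      case False
      then obtain y where y: "y \<in> K" "\<And>x. x \<in> K \<Longrightarrow> excess (fst y) (snd y) \<le> excess (fst x) (snd x)"
        using continuous_attains_inf[OF \<open>compact K\<close> _ continuous_on_excess] by blast
      have "excess (fst y) (snd y) \<noteq> 0"
        using y(1) that Mu[of "fst y" "snd y"] M0 by (auto simp: K_def)
      then have "0 < excess (fst y) (snd y)" using excess_nonneg[of "fst y" "snd y"] by linarith
      then show ?thesis using y(2) by blast
    qed
    then obtain d where d: "d > 0" "\<And>x. x \<in> K \<Longrightarrow> d \<le> excess (fst x) (snd x)" by blast
    show ?thesis
    proof (intro exI[of _ "d * e / (2 * C)"] conjI allI impI)
      show "0 < d * e / (2 * C)" using d(1) that C(2) by simp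
      fix t assume t: "0 \<le> t \<and> t < d * e / (2 * C)"
      show "M t \<le> e"
      proof (rule Mle)
        fix x assume x: "x \<in> F \<times> F"
        show "\<tau> t x \<le> e"
        proof (cases "x \<in> K")
          case True
          have "t / excess (fst x) (snd x) \<le> t / d"
            using d(1) d(2)[OF True] t by (simp add: frac_le)
          then have "min 1 (t / excess (fst x) (snd x)) \<le> t / d" by simp
          then have "\<tau> t x \<le> 2 * C * (t / d)"
            unfolding \<tau>_def using D2[OF x] D0[of x] C(2) t excess_nonneg d(1)
            by (intro mult_mono) auto
          also have "\<dots> \<le> e" using t d(1) C(2) by (simp add: field_simps)
          finally show ?thesis .
        next
          case False
          then have "D x \<le> e" using x that by (auto simp: K_def D_def)
          then show ?thesis using \<tau>D[of t x] by linarith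
        qed
      qed
    qed
  qed
  define \<Phi> where "\<Phi> = (\<lambda>p. SUP q \<in> F. u q - M (excess q p))"
  have Mnn: "0 \<le> M (excess q p)" for q p
    using Mmono[OF order_refl excess_nonneg] M0 by simp
  have bdd2: "bdd_above ((\<lambda>q. u q - M (excess q p)) ` F)" for p
  proof (rule bdd_aboveI2)
    fix q assume "q \<in> F"
    then show "u q - M (excess q p) \<le> C" using C(1)[of q] Mnn[of q p] by linarith
  qed
  have up: "q \<in> F \<Longrightarrow> u q - M (excess q p) \<le> \<Phi> p" for q p
    unfolding \<Phi>_def by (rule cSUP_upper[OF _ bdd2])
  have low: "\<Phi> p \<le> B" if "\<And>q. q \<in> F \<Longrightarrow> u q - M (excess q p) \<le> B" for p B
    unfolding \<Phi>_def by (rule cSUP_least) (use that False in auto)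
  have shift: "\<Phi> p \<le> \<Phi> p' + M (excess p p')" for p p'
  proof (rule low)
    fix q assume q: "q \<in> F"
    have "M (excess q p') \<le> M (excess q p) + M (excess p p')"
      using Mmono[OF excess_nonneg excess_triangle] Msub[OF excess_nonneg excess_nonneg]
      by (meson order_trans)
    then show "u q - M (excess q p) \<le> \<Phi> p' + M (excess p p')" using up[OF q, of p'] by linarith
  qed
  show ?thesis
  proof (rule that[of \<Phi>])
    show "\<Phi> (x, w) \<le> \<Phi> (x', w)" if "x \<le> x'" for x x' w
      using shift[of "(x, w)" "(x', w)"] that M0 by (simp add: excess_def)
    show "\<Phi> p = u p" if "p \<in> F" for p
    proof (rule antisym)
      show "\<Phi> p \<le> u p"
        by (rule low) (use Mu that in \<open>smt (verit)\<close>)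
      show "u p \<le> \<Phi> p" using up[OF that, of p] by (simp add: excess_self M0)
    qed
    show "continuous_on UNIV \<Phi>"
    proof (simp only: continuous_on_iff, intro ballI allI impI)
      fix p :: "real \<times> real" and e :: real assume "0 < e"
      then obtain d where d: "d > 0" "\<And>t. 0 \<le> t \<Longrightarrow> t < d \<Longrightarrow> M t \<le> e / 2"
        using Msmall[of "e / 2"] by auto
      show "\<exists>d>0. \<forall>p'\<in>UNIV. dist p' p < d \<longrightarrow> dist (\<Phi> p') (\<Phi> p) < e"
      proof (intro exI[of _ "d / 2"] conjI ballI impI)
        show "0 < d / 2" using d by simp
        fix p' :: "real \<times> real" assume "dist p' p < d / 2"
        then have "dist (fst p') (fst p) < d / 2" "dist (snd p') (snd p) < d / 2"
          using dist_fst_le dist_snd_le by (meson le_less_trans)+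
        then have "excess p' p < d" "excess p p' < d"
          unfolding excess_def dist_real_def by linarith+
        then have "M (excess p' p) \<le> e / 2" "M (excess p p') \<le> e / 2"
          using d(2) excess_nonneg by blast+
        then show "dist (\<Phi> p') (\<Phi> p) < e"
          using shift[of p p'] shift[of p' p] \<open>0 < e\<close> by (simp add: dist_real_def abs_le_iff)
      qed
    qed
  qed
qed

text \<open>Increasing homeomorphisms of the line can be prescribed at finitely many points. They are used to
  turn weakly monotone maps into strictly monotone ones without moving the marked points.\<close>

lemma strict_mono_interpolation:
  fixes S :: "real set" and u :: "real \<Rightarrow> real"
  assumes "finite S" "strict_mono_on S u"
  shows "\<exists>\<theta>. continuous_on UNIV \<theta> \<and> strict_mono \<theta> \<and> surj \<theta> \<and> (\<forall>s\<in>S. \<theta> s = u s)"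
  using assms
proof (induction rule: finite_linorder_max_induct)
  case empty
  show ?case by (intro exI[of _ id]) (auto simp: strict_mono_def)
next
  case (insert b A)
  then obtain \<theta> where \<theta>: "continuous_on UNIV \<theta>" "strict_mono \<theta>" "surj \<theta>" "\<forall>s\<in>A. \<theta> s = u s"
    by (auto simp: strict_mono_on_def)
  show ?case
  proof (cases "A = {}")
    case True
    have "surj (\<lambda>x. x + (u b - b))" by (rule surjI[of _ "\<lambda>y. y - (u b - b)"]) simp
    then show ?thesis
      by (intro exI[of _ "\<lambda>x. x + (u b - b)"])
         (auto simp: True strict_mono_def intro!: continuous_intros)
  next
    case False
    define m where "m = Max A"
    have m: "m \<in> A" "\<And>a. a \<in> A \<Longrightarrow> a \<le> m" using False insert by (auto simp: m_def)
    then have mb: "m < b" and um: "u m < u b" using insert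
      by (auto simp: strict_mono_on_def)
    define r where "r = (u b - u m) / (b - m)"
    have r: "r > 0" using mb um by (simp add: r_def)
    define \<theta>' where "\<theta>' = (\<lambda>y. if y \<le> m then \<theta> y else u m + r * (y - m))"
    have \<theta>m: "\<theta> m = u m" using \<theta> m by auto
    have "continuous_on ({..m} \<union> {m..}) \<theta>'"
      unfolding \<theta>'_def
      by (intro continuous_on_If continuous_intros continuous_on_subset[OF \<theta>(1)])
         (auto simp: \<theta>m)
    moreover have "{..m} \<union> {m..} = (UNIV :: real set)" by auto
    moreover have "strict_mono \<theta>'"
    proof (rule strict_monoI)
      fix x y :: real assume xy: "x < y"
      have "\<theta> x \<le> u m" if "x \<le> m" using that \<theta>(2) \<theta>m
        by (metis strict_mono_less_eq)
      moreover have "0 < r * (y - m)" if "m < y" using r that by simp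
      moreover have "r * (x - m) < r * (y - m)" using r xy by simp
      moreover have "\<theta> x < \<theta> y" using xy \<theta>(2) by (simp add: strict_mono_less)
      ultimately show "\<theta>' x < \<theta>' y" using xy by (auto simp: \<theta>'_def)
    qed
    moreover have "surj \<theta>'"
      unfolding surj_def
    proof
      fix t
      show "\<exists>x. t = \<theta>' x"
      proof (cases "t \<le> u m")
        case True
        obtain x where x: "t = \<theta> x" using \<theta>(3) by (auto simp: surj_def)
        then have "x \<le> m" using True \<theta>(2) \<theta>m by (metis strict_mono_less_eq)
        then show ?thesis using x by (auto simp: \<theta>'_def)
      next
        case False
        then have "t = \<theta>' (m + (t - u m) / r)" using r by (auto simp: \<theta>'_def field_simps)
        then show ?thesis by blast
      qed
    qed
    moreover have "\<theta>' s = u s" if "s \<in> insert b A" for s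
      using that m(2) \<theta>(4) mb by (auto simp: \<theta>'_def r_def)
    ultimately show ?thesis by (intro exI[of _ \<theta>']) simp
  qed
qed

section \<open>Layouts of an interval\<close>

text \<open>A layout is recorded through the image \<open>\<Gamma>\<close> of a path in the strip of height one. Its first
  coordinate is the (slowed down) parameter of the interval and runs monotonically; its second
  coordinate is the height at which this part of the interval is going to be drawn. Working with the
  image instead of a parametrization makes gluing a matter of taking unions.\<close>

definition rightward_path :: "real \<times> real \<Rightarrow> (real \<times> real) set \<Rightarrow> real \<times> real \<Rightarrow> bool" where
  "rightward_path P \<Gamma> Q \<longleftrightarrow>
     (\<exists>g. path g \<and> path_image g = \<Gamma> \<and> pathstart g = P \<and> pathfinish g = Q \<and> mono_on {0..1} (fst \<circ> g))"

lemma rightward_path_join: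
  assumes "rightward_path P \<Gamma> Q" "rightward_path Q \<Delta> R"
  shows "rightward_path P (\<Gamma> \<union> \<Delta>) R"
proof -
  obtain g h where g: "path g" "path_image g = \<Gamma>" "pathstart g = P" "pathfinish g = Q" "mono_on {0..1} (fst \<circ> g)"
    and h: "path h" "path_image h = \<Delta>" "pathstart h = Q" "pathfinish h = R" "mono_on {0..1} (fst \<circ> h)"
    using assms unfolding rightward_path_def by metis
  have le: "fst (g s) \<le> fst Q" "fst Q \<le> fst (h s)" if "s \<in> {0..1}" for s
    using that mono_onD[OF g(5), of s 1] mono_onD[OF h(5), of 0 s] g(4) h(3)
    by (auto simp: pathfinish_def pathstart_def)
  have "mono_on {0..1} (fst \<circ> (g +++ h))"
  proof (rule mono_onI)
    fix r s :: real assume rs: "r \<in> {0..1}" "s \<in> {0..1}" "r \<le> s"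
    consider "s \<le> 1/2" | "r \<le> 1/2" "1/2 < s" | "1/2 < r" using rs by linarith
    then show "(fst \<circ> (g +++ h)) r \<le> (fst \<circ> (g +++ h)) s"
    proof cases
      case 1 then show ?thesis using rs mono_onD[OF g(5), of "2 * r" "2 * s"] by (simp add: joinpaths_def)
    next
      case 2 then show ?thesis using rs le(1)[of "2 * r"] le(2)[of "2 * s - 1"] by (simp add: joinpaths_def)
    next
      case 3 then show ?thesis using rs mono_onD[OF h(5), of "2 * r - 1" "2 * s - 1"] by (simp add: joinpaths_def)
    qed
  qed
  then show ?thesis unfolding rightward_path_def
    using g h by (intro exI[of _ "g +++ h"]) (simp add: path_image_join)
qed

lemma rightward_path_rescale:
  assumes "rightward_path P \<Gamma> Q"
  shows "rightward_path (apsnd (\<lambda>y. \<alpha> * y + \<beta>) P) (apsnd (\<lambda>y. \<alpha> * y + \<beta>) ` \<Gamma>) (apsnd (\<lambda>y. \<alpha> * y + \<beta>) Q)"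
proof -
  obtain g where g: "path g" "path_image g = \<Gamma>" "pathstart g = P" "pathfinish g = Q" "mono_on {0..1} (fst \<circ> g)"
    using assms unfolding rightward_path_def by metis
  have *: "apsnd (\<lambda>y. \<alpha> * y + \<beta>) = (\<lambda>p. (fst p, \<alpha> * snd p + \<beta>))" by (auto simp: apsnd_def)
  have "path (\<lambda>t. (fst (g t), \<alpha> * snd (g t) + \<beta>))"
    using g(1) unfolding path_def by (intro continuous_intros)
  then show ?thesis unfolding rightward_path_def *
    using g by (intro exI[of _ "\<lambda>t. (fst (g t), \<alpha> * snd (g t) + \<beta>)"])
      (auto simp: path_image_def pathstart_def pathfinish_def image_image o_def)
qed

lemma rescale_mem:
  fixes \<alpha> :: real
  assumes "\<alpha> \<noteq> 0"
  shows "(x, w) \<in> apsnd (\<lambda>y. \<alpha> * y + \<beta>) ` \<Gamma> \<longleftrightarrow> (x, (w - \<beta>) / \<alpha>) \<in> \<Gamma>"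
proof
  assume "(x, (w - \<beta>) / \<alpha>) \<in> \<Gamma>"
  moreover have "(x, w) = apsnd (\<lambda>y. \<alpha> * y + \<beta>) (x, (w - \<beta>) / \<alpha>)" using assms by simp
  ultimately show "(x, w) \<in> apsnd (\<lambda>y. \<alpha> * y + \<beta>) ` \<Gamma>" by blast
qed (use assms in auto)

lemma rightward_path_segment:
  assumes "x \<le> x'"
  shows "rightward_path (x, y) ((\<lambda>t. (x + t * (x' - x), y + t * (y' - y))) ` {0..1}) (x', y')"
  unfolding rightward_path_def
  using assms
  by (intro exI[of _ "\<lambda>t. (x + t * (x' - x), y + t * (y' - y))"])
     (auto simp: path_def path_image_def pathstart_def pathfinish_def intro!: continuous_intros mono_onI mult_right_mono)

lemma rightward_path_ends:
  assumes "rightward_path P \<Gamma> Q"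
  shows "P \<in> \<Gamma>" "Q \<in> \<Gamma>"
  using assms unfolding rightward_path_def by (auto simp: pathstart_in_path_image pathfinish_in_path_image)

lemma rightward_path_between:
  assumes "rightward_path P \<Gamma> Q" "p \<in> \<Gamma>"
  shows "fst P \<le> fst p" "fst p \<le> fst Q"
proof -
  obtain g s where g: "pathstart g = P" "pathfinish g = Q" "mono_on {0..1} (fst \<circ> g)"
    and s: "p = g s" "s \<in> {0..1}"
    using assms unfolding rightward_path_def path_image_def by auto
  show "fst P \<le> fst p" "fst p \<le> fst Q"
    using mono_onD[OF g(3), of 0 s] mono_onD[OF g(3), of s 1] s g(1,2)
    by (auto simp: pathstart_def pathfinish_def)
qed

lemma rightward_path_vertical:
  "rightward_path (x, y) ({x} \<times> closed_segment y y') (x, y')"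
proof -
  have "(\<lambda>t. (x + t * (x - x), y + t * (y' - y))) ` {0..1} = {x} \<times> closed_segment y y'"
  proof -
    have "(\<lambda>t. y + t * (y' - y)) = (\<lambda>u. (1 - u) *\<^sub>R y + u *\<^sub>R y')" by (auto simp: algebra_simps)
    then have "closed_segment y y' = (\<lambda>t. y + t * (y' - y)) ` {0..1}"
      unfolding closed_segment_image_interval by (simp only:)
    then show ?thesis by auto
  qed
  then show ?thesis using rightward_path_segment[of x x y y'] by simp
qed

text \<open>If the point of \<open>\<Gamma>\<close> over the parameter \<open>x\<close> at height \<open>y\<close> is drawn at the planar point \<open>(f x, y)\<close>,
  then \<open>slicewise_mono\<close> says that at each height the strands are met in the order of their
  parameters, so that the drawing can be obtained by a motion preserving horizontal lines, and
  \<open>exposed_below\<close> says that the vertical ray below \<open>z\<close> can take part in that motion: all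
  strands at or below its height stay on the same side of it.\<close>

definition slicewise_mono :: "(real \<Rightarrow> real) \<Rightarrow> (real \<times> real) set \<Rightarrow> bool" where
  "slicewise_mono f \<Gamma> \<longleftrightarrow> (\<forall>x x' y. (x, y) \<in> \<Gamma> \<longrightarrow> (x', y) \<in> \<Gamma> \<longrightarrow> x \<le> x' \<longrightarrow> f x \<le> f x')"

definition exposed_below :: "(real \<Rightarrow> real) \<Rightarrow> (real \<times> real) set \<Rightarrow> real \<Rightarrow> bool" where
  "exposed_below f \<Gamma> z \<longleftrightarrow> (\<exists>y. (z, y) \<in> \<Gamma> \<and>
     (\<forall>x y'. (x, y') \<in> \<Gamma> \<longrightarrow> y' \<le> y \<longrightarrow> (x \<le> z \<longrightarrow> f x \<le> f z) \<and> (z \<le> x \<longrightarrow> f z \<le> f x)))"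

text \<open>The flags \<open>L\<close> and \<open>R\<close> free the left end from having to lie at the bottom and the right end from
  having to lie at the top. A free end cannot be joined to a neighbouring piece, so it has to be an end
  of the whole interval.\<close>

definition layout :: "(real \<Rightarrow> real) \<Rightarrow> real set \<Rightarrow> bool \<Rightarrow> bool \<Rightarrow> real \<Rightarrow> real \<Rightarrow> bool" where
  "layout f Z L R p q \<longleftrightarrow> (\<exists>\<Gamma> y y'. rightward_path (p, y) \<Gamma> (q, y') \<and> \<Gamma> \<subseteq> UNIV \<times> {0..1} \<and>
     (L \<or> y = 0) \<and> (R \<or> y' = 1) \<and> slicewise_mono f \<Gamma> \<and> (\<forall>z\<in>Z \<inter> {p..q}. exposed_below f \<Gamma> z))"

text \<open>Without visors, height can simply be proportional to the parameter: below \<open>z\<close> there are only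
  earlier points, and none of them has a larger value.\<close>

lemma layout_of_no_visor:
  assumes "p < q" and "\<And>z x. z \<in> Z \<inter> {p..q} \<Longrightarrow> x \<in> {p..z} \<Longrightarrow> f x \<le> f z"
  shows "layout f Z L R p q"
proof -
  define \<Gamma> where "\<Gamma> = (\<lambda>t::real. (p + t * (q - p), 0 + t * (1 - 0 :: real))) ` {0..1}"
  have \<Gamma>: "(x, y) \<in> \<Gamma> \<longleftrightarrow> y \<in> {0..1} \<and> x = p + y * (q - p)" for x y
    by (auto simp: \<Gamma>_def)
  have "rightward_path (p, 0) \<Gamma> (q, 1)"
    unfolding \<Gamma>_def using assms(1) by (intro rightward_path_segment) simp
  moreover have "\<Gamma> \<subseteq> UNIV \<times> {0..1}" by (auto simp: \<Gamma>_def)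
  moreover have "slicewise_mono f \<Gamma>" by (auto simp: slicewise_mono_def \<Gamma>)
  moreover have "exposed_below f \<Gamma> z" if z: "z \<in> Z \<inter> {p..q}" for z
    unfolding exposed_below_def
  proof (intro exI[of _ "(z - p) / (q - p)"] conjI allI impI)
    show "(z, (z - p) / (q - p)) \<in> \<Gamma>" using z assms(1) by (auto simp: \<Gamma> field_simps)
    fix x y' assume x: "(x, y') \<in> \<Gamma>" "y' \<le> (z - p) / (q - p)"
    then have "y' * (q - p) \<le> z - p" using assms(1) by (simp add: field_simps)
    then have xz: "p \<le> x" "x \<le> z" using x assms(1) by (auto simp: \<Gamma>)
    then show "f x \<le> f z" using assms(2)[OF z, of x] by simp
    show "f z \<le> f x" if "z \<le> x" using that xz by simp
  qed
  ultimately show ?thesis unfolding layout_def by blast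
qed

text \<open>The two layouts are compressed to the lower and the upper half of the strip. A ray from the upper
  half then has to descend past all of the lower one, which is what the last hypothesis permits.\<close>

lemma layout_stack:
  assumes lo: "layout f Z L False p m" and hi: "layout f Z False R m q"
    and below: "\<And>z x. z \<in> Z \<inter> {m..q} \<Longrightarrow> x \<in> {p..m} \<Longrightarrow> f x \<le> f z"
  shows "layout f Z L R p q"
proof -
  obtain \<Gamma> y where \<Gamma>: "rightward_path (p, y) \<Gamma> (m, 1)" "\<Gamma> \<subseteq> UNIV \<times> {0..1}" "L \<or> y = 0"
    "slicewise_mono f \<Gamma>" "\<And>z. z \<in> Z \<inter> {p..m} \<Longrightarrow> exposed_below f \<Gamma> z"
    using lo unfolding layout_def by auto
  obtain \<Delta> y' where \<Delta>: "rightward_path (m, 0) \<Delta> (q, y')" "\<Delta> \<subseteq> UNIV \<times> {0..1}" "R \<or> y' = 1"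
    "slicewise_mono f \<Delta>" "\<And>z. z \<in> Z \<inter> {m..q} \<Longrightarrow> exposed_below f \<Delta> z"
    using hi unfolding layout_def by auto
  define G where "G = apsnd (\<lambda>y. 1/2 * y + 0) ` \<Gamma> \<union> apsnd (\<lambda>y. 1/2 * y + 1/2) ` \<Delta>"
  have G: "(x, w) \<in> G \<longleftrightarrow> (x, 2 * w) \<in> \<Gamma> \<or> (x, 2 * w - 1) \<in> \<Delta>" for x w
  proof -
    have "(w - 1/2) / (1/2) = 2 * w - 1" "(w - 0) / (1/2) = 2 * w" by (auto simp: field_simps)
    then show ?thesis
      using rescale_mem[of "1/2" x w 0 \<Gamma>] rescale_mem[of "1/2" x w "1/2" \<Delta>]
      unfolding G_def Un_iff by (simp only:)
  qed
  have "rightward_path (p, y / 2) G (q, y' / 2 + 1/2)"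
    unfolding G_def using rightward_path_join[OF rightward_path_rescale[OF \<Gamma>(1), of "1/2" 0]]
      rightward_path_rescale[OF \<Delta>(1), of "1/2" "1/2"] by simp
  have r\<Gamma>: "p \<le> x \<and> x \<le> m \<and> 0 \<le> w \<and> w \<le> 1" if "(x, w) \<in> \<Gamma>" for x w
    using rightward_path_between[OF \<Gamma>(1) that] \<Gamma>(2) that by auto
  have r\<Delta>: "m \<le> x \<and> x \<le> q \<and> 0 \<le> w \<and> w \<le> 1" if "(x, w) \<in> \<Delta>" for x w
    using rightward_path_between[OF \<Delta>(1) that] \<Delta>(2) that by auto
  have s\<Gamma>: "f x \<le> f x'" if "(x, w) \<in> \<Gamma>" "(x', w) \<in> \<Gamma>" "x \<le> x'" for x x' w
    using \<Gamma>(4) that unfolding slicewise_mono_def by blast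
  have s\<Delta>: "f x \<le> f x'" if "(x, w) \<in> \<Delta>" "(x', w) \<in> \<Delta>" "x \<le> x'" for x x' w
    using \<Delta>(4) that unfolding slicewise_mono_def by blast
  have top: "f x \<le> f m" if "(x, 1) \<in> \<Gamma>" for x
    using s\<Gamma>[OF that] rightward_path_ends(2)[OF \<Gamma>(1)] r\<Gamma>[OF that] by blast
  have bot: "f m \<le> f x" if "(x, 0) \<in> \<Delta>" for x
    using s\<Delta>[OF _ that] rightward_path_ends(1)[OF \<Delta>(1)] r\<Delta>[OF that] by blast
  have cross: "w = 1 \<and> w' = 0 \<and> f x \<le> f x'" if "(x, w) \<in> \<Gamma>" "(x', w') \<in> \<Delta>" "1 + w' \<le> w" for x x' w w'
  proof -
    have "w = 1" "w' = 0" using r\<Gamma>[OF that(1)] r\<Delta>[OF that(2)] that(3) by linarith+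
    then show ?thesis using top bot that by (meson order_trans)
  qed
  have "slicewise_mono f G" unfolding slicewise_mono_def
  proof (intro allI impI)
    fix x x' w assume x: "(x, w) \<in> G" "(x', w) \<in> G" "x \<le> x'"
    consider "(x, 2 * w) \<in> \<Gamma>" "(x', 2 * w) \<in> \<Gamma>" | "(x, 2 * w - 1) \<in> \<Delta>" "(x', 2 * w - 1) \<in> \<Delta>"
      | "(x, 2 * w) \<in> \<Gamma>" "(x', 2 * w - 1) \<in> \<Delta>" | "(x, 2 * w - 1) \<in> \<Delta>" "(x', 2 * w) \<in> \<Gamma>"
      using x by (auto simp: G)
    then show "f x \<le> f x'"
    proof cases
      case 1 then show ?thesis using s\<Gamma> x by blast
    next
      case 2 then show ?thesis using s\<Delta> x by blast
    next
      case 3 then show ?thesis using cross by force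
    next
      case 4 then have "x = x'" using r\<Gamma> r\<Delta> x(3) by (meson order.antisym order.trans)
      then show ?thesis by simp
    qed
  qed
  moreover have "exposed_below f G z" if z: "z \<in> Z \<inter> {p..q}" for z
  proof (cases "z < m")
    case True
    then have "exposed_below f \<Gamma> z" using \<Gamma>(5) z by auto
    then obtain w where w: "(z, w) \<in> \<Gamma>" "\<And>x y'. (x, y') \<in> \<Gamma> \<Longrightarrow> y' \<le> w \<Longrightarrow> (x \<le> z \<longrightarrow> f x \<le> f z) \<and> (z \<le> x \<longrightarrow> f z \<le> f x)"
      unfolding exposed_below_def by blast
    show ?thesis unfolding exposed_below_def
    proof (intro exI[of _ "w / 2"] conjI[of "_ \<in> _"] allI impI)
      show "(z, w / 2) \<in> G" using w by (simp add: G)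
      fix x v assume x: "(x, v) \<in> G" "v \<le> w / 2"
      then consider "(x, 2 * v) \<in> \<Gamma>" | "(x, 2 * v - 1) \<in> \<Delta>" by (auto simp: G)
      then show "(x \<le> z \<longrightarrow> f x \<le> f z) \<and> (z \<le> x \<longrightarrow> f z \<le> f x)"
      proof cases
        case 1 then show ?thesis using w(2) x by auto
      next
        case 2
        then have "f z \<le> f x" "m \<le> x" using cross[OF w(1) 2] r\<Delta> x by auto
        then show ?thesis using True by simp
      qed
    qed
  next
    case False
    then have zm: "z \<in> Z \<inter> {m..q}" using z by auto
    then obtain w where w: "(z, w) \<in> \<Delta>" "\<And>x y'. (x, y') \<in> \<Delta> \<Longrightarrow> y' \<le> w \<Longrightarrow> (x \<le> z \<longrightarrow> f x \<le> f z) \<and> (z \<le> x \<longrightarrow> f z \<le> f x)"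
      using \<Delta>(5) unfolding exposed_below_def by blast
    show ?thesis unfolding exposed_below_def
    proof (intro exI[of _ "w / 2 + 1/2"] conjI[of "_ \<in> _"] allI impI)
      show "(z, w / 2 + 1/2) \<in> G" using w by (simp add: G)
      fix x v assume x: "(x, v) \<in> G" "v \<le> w / 2 + 1/2"
      then consider "(x, 2 * v - 1) \<in> \<Delta>" | "(x, 2 * v) \<in> \<Gamma>" by (auto simp: G)
      then show "(x \<le> z \<longrightarrow> f x \<le> f z) \<and> (z \<le> x \<longrightarrow> f z \<le> f x)"
      proof cases
        case 1 then show ?thesis using w(2) x by auto
      next
        case 2
        then have "x \<in> {p..m}" using r\<Gamma> by auto
        then show ?thesis using below[OF zm, of x] zm by (cases "x = z") auto
      qed
    qed
  qed
  moreover have "G \<subseteq> UNIV \<times> {0..1}"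
  proof (clarsimp simp: G)
    fix x w assume "(x, 2 * w) \<in> \<Gamma> \<or> (x, 2 * w - 1) \<in> \<Delta>"
    then show "0 \<le> w \<and> w \<le> 1" using r\<Gamma>[of x "2 * w"] r\<Delta>[of x "2 * w - 1"] by linarith
  qed
  ultimately show ?thesis unfolding layout_def
    using \<open>rightward_path (p, y / 2) G (q, y' / 2 + 1/2)\<close> \<Gamma>(3) \<Delta>(3)
    by (intro exI[of _ G] exI[of _ "y / 2"] exI[of _ "y' / 2 + 1/2"]) auto
qed

text \<open>The use of a removing triple \<open>(a, b, c)\<close>. The part over \<open>[b, c]\<close> is drawn in the lowest third and
  the part over \<open>[a, b]\<close>, which contains the visor, is drawn upside down in the highest third. The
  pieces are joined by three vertical segments: one over \<open>a\<close> going up on the left of everything,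
  since \<open>f a\<close> is minimal, one over \<open>b\<close> going down on the left of the part over \<open>[b, c]\<close>, since
  \<open>f b\<close> is minimal there, and one over \<open>c\<close> going up on the right of the flipped part. If an end is
  free (\<open>L'\<close>, \<open>R'\<close>), its vertical segment is omitted, and with it the condition on \<open>f a\<close> or \<open>f c\<close>.\<close>

lemma layout_flip:
  assumes "a < b" and B: "layout f Z False R' b c"
    and noZ: "Z \<inter> {a<..<b} = {}"
    and L': "L' \<Longrightarrow> L \<and> a \<notin> Z" "\<And>x. \<not> L' \<Longrightarrow> x \<in> {a..b} \<Longrightarrow> f a \<le> f x"
    and R': "R' \<Longrightarrow> R" "\<And>x. \<not> R' \<Longrightarrow> x \<in> {a..b} \<Longrightarrow> f x \<le> f c"
    and fb: "\<And>x. x \<in> {b..c} \<Longrightarrow> f b \<le> f x"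
  shows "layout f Z L R a c"
proof -
  obtain \<Gamma> y where \<Gamma>: "rightward_path (b, 0) \<Gamma> (c, y)" "\<Gamma> \<subseteq> UNIV \<times> {0..1}" "R' \<or> y = 1"
    "slicewise_mono f \<Gamma>" "\<And>z. z \<in> Z \<inter> {b..c} \<Longrightarrow> exposed_below f \<Gamma> z"
    using B unfolding layout_def by auto
  have r\<Gamma>: "b \<le> x \<and> x \<le> c \<and> 0 \<le> w \<and> w \<le> 1" if "(x, w) \<in> \<Gamma>" for x w
    using rightward_path_between[OF \<Gamma>(1) that] \<Gamma>(2) that by auto
  have s\<Gamma>: "f x \<le> f x'" if "(x, w) \<in> \<Gamma>" "(x', w) \<in> \<Gamma>" "x \<le> x'" for x x' w
    using \<Gamma>(4) that unfolding slicewise_mono_def by blast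
  have top: "f x \<le> f c" if "\<not> R'" "(x, 1) \<in> \<Gamma>" for x
    using s\<Gamma>[OF that(2)] rightward_path_ends(2)[OF \<Gamma>(1)] \<Gamma>(3) r\<Gamma>[OF that(2)] that(1) by blast
  have bc: "b \<le> c" using rightward_path_between[OF \<Gamma>(1) rightward_path_ends(1)[OF \<Gamma>(1)]] by simp
  have fa: "f a \<le> f x" if "\<not> L'" "x \<in> {a..c}" for x
  proof (cases "x \<le> b")
    case False
    then show ?thesis using L'(2)[OF that(1), of b] fb[of x] that \<open>a < b\<close> by auto
  qed (use L'(2) that in auto)
  define Va where "Va = (if L' then {} else {a} \<times> closed_segment (0::real) 1)"
  define A where "A = (\<lambda>t. (a + t * (b - a), 1 + t * (2/3 - 1 :: real))) ` {0..1}"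
  define Vb where "Vb = {b} \<times> closed_segment (2/3::real) 0"
  define B where "B = apsnd (\<lambda>y. 1/3 * y + 0) ` \<Gamma>"
  define Vc where "Vc = (if R' then {} else {c} \<times> closed_segment (1/3::real) 1)"
  define G where "G = (Va \<union> ((A \<union> Vb) \<union> B)) \<union> Vc"
  have mVa: "(x, w) \<in> Va \<longleftrightarrow> \<not> L' \<and> x = a \<and> 0 \<le> w \<and> w \<le> 1" for x w
    by (auto simp: Va_def closed_segment_eq_real_ivl)
  have mVb: "(x, w) \<in> Vb \<longleftrightarrow> x = b \<and> 0 \<le> w \<and> w \<le> 2/3" for x w
    by (auto simp: Vb_def closed_segment_eq_real_ivl)
  have mVc: "(x, w) \<in> Vc \<longleftrightarrow> \<not> R' \<and> x = c \<and> 1/3 \<le> w \<and> w \<le> 1" for x w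
    by (auto simp: Vc_def closed_segment_eq_real_ivl)
  have mB: "(x, w) \<in> B \<longleftrightarrow> (x, 3 * w) \<in> \<Gamma>" for x w
    unfolding B_def by (subst rescale_mem) (simp_all add: field_simps)
  have mA: "a \<le> x \<and> x \<le> b \<and> 2/3 \<le> w \<and> w \<le> 1 \<and> x = a + (3 - 3 * w) * (b - a)" if "(x, w) \<in> A" for x w
    using that \<open>a < b\<close> by (auto simp: A_def) (smt (verit) mult_left_le_one_le mult_nonneg_nonneg)+
  have Atop: "x = b" if "(x, w) \<in> A" "w \<le> 2/3" for x w
  proof -
    have "3 - 3 * w = 1" using mA[OF that(1)] that(2) by simp
    moreover have "x = a + (3 - 3 * w) * (b - a)" using mA[OF that(1)] by blast
    ultimately show ?thesis by simp
  qed
  have core: "rightward_path (a, 1) ((A \<union> Vb) \<union> B) (c, y / 3)"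
  proof (intro rightward_path_join)
    show "rightward_path (a, 1) A (b, 2/3)"
      unfolding A_def using \<open>a < b\<close> by (intro rightward_path_segment) simp
    show "rightward_path (b, 2/3) Vb (b, 0)"
      unfolding Vb_def by (rule rightward_path_vertical)
    show "rightward_path (b, 0) B (c, y / 3)"
      unfolding B_def using rightward_path_rescale[OF \<Gamma>(1), of "1/3" 0] by simp
  qed
  have left: "rightward_path (a, if L' then 1 else 0) (Va \<union> ((A \<union> Vb) \<union> B)) (c, y / 3)"
    using core rightward_path_join[OF rightward_path_vertical core] by (auto simp: Va_def)
  have path: "rightward_path (a, if L' then 1 else 0) G (c, if R' then y / 3 else 1)"
  proof (cases R')
    case False
    then have "y = 1" using \<Gamma>(3) by simp
    then show ?thesis
      using left rightward_path_join[OF left] rightward_path_vertical[of c "1/3" 1] False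
      by (simp add: Vc_def G_def)
  qed (use left in \<open>simp add: Vc_def G_def\<close>)
  have mG: "a \<le> x \<and> x \<le> c \<and> 0 \<le> w \<and> w \<le> 1" if "(x, w) \<in> G" for x w
    using that \<open>a < b\<close> bc r\<Gamma>[of x "3 * w"] mA[of x w] unfolding G_def Un_iff mVa mVb mVc mB by auto
  have "slicewise_mono f G" unfolding slicewise_mono_def
  proof (intro allI impI)
    fix x x' w assume x: "(x, w) \<in> G" "(x', w) \<in> G" "x \<le> x'"
    show "f x \<le> f x'"
    proof (cases "x = x'")
      case False
      then have lt: "x < x'" using x by simp
      have xx: "a \<le> x" "x \<le> c" "a \<le> x'" "x' \<le> c" using mG x by blast+
      consider "(x, w) \<in> Va" | "(x', w) \<in> Vc" "(x, w) \<in> A \<union> Vb" | "(x', w) \<in> Vc" "(x, w) \<in> B"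
        | "(x, w) \<in> A" "(x', w) \<in> A \<union> Vb \<union> B" | "(x, w) \<in> Vb" "(x', w) \<in> A \<union> Vb \<union> B"
        | "(x, w) \<in> B" "(x', w) \<in> A \<union> Vb" | "(x, w) \<in> B" "(x', w) \<in> B"
      proof -
        have "(x, w) \<notin> Vc" "(x', w) \<notin> Va" using lt xx by (auto simp: mVa mVc)
        then show ?thesis using x(1,2) that unfolding G_def by blast
      qed
      then show ?thesis
      proof cases
        case 1 then show ?thesis using fa xx by (simp add: mVa)
      next
        case 2
        then have "x \<in> {a..b}" using mA[of x w] \<open>a < b\<close> by (auto simp: mVb)
        then show ?thesis using 2 R'(2) by (simp add: mVc)
      next
        case 3
        then have "3 * w = 1" using r\<Gamma>[of x "3 * w"] by (simp add: mB mVc)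
        then have "(x, 1) \<in> \<Gamma>" using 3(2) by (simp only: mB)
        then show ?thesis using 3 top by (simp add: mVc)
      next
        case 4
        have "(x', w) \<notin> A" using mA[OF 4(1)] mA[of x' w] lt by linarith
        moreover have "(x', w) \<notin> Vb" using Atop[OF 4(1)] mA[OF 4(1)] lt by (auto simp: mVb)
        moreover have "(x', w) \<notin> B" using mA[OF 4(1)] r\<Gamma>[of x' "3 * w"] by (auto simp: mB)
        ultimately show ?thesis using 4(2) by blast
      next
        case 5
        then have "x = b" by (simp add: mVb)
        then have "x' \<in> {b..c}" using lt xx by simp
        then show ?thesis using fb \<open>x = b\<close> by blast
      next
        case 6
        have "b \<le> x" "w \<le> 1/3" using r\<Gamma>[of x "3 * w"] 6(1) by (simp_all add: mB)
        then have "(x', w) \<notin> A" "(x', w) \<notin> Vb" using mA[of x' w] lt by (auto simp: mVb)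
        then show ?thesis using 6(2) by blast
      next
        case 7
        then show ?thesis using s\<Gamma> x(3) unfolding mB by blast
      qed
    qed simp
  qed
  moreover have "exposed_below f G z" if z: "z \<in> Z \<inter> {a..c}" for z
  proof (cases "z = a")
    case True
    then have "\<not> L'" using L'(1) z by auto
    show ?thesis unfolding exposed_below_def
    proof (intro exI[of _ 0] conjI[of "_ \<in> _"] allI impI)
      show "(z, 0) \<in> G" using True \<open>\<not> L'\<close> by (simp add: G_def mVa)
      fix x y' assume "(x, y') \<in> G"
      then have "x \<in> {a..c}" using mG[of x y'] by simp
      then show "(x \<le> z \<longrightarrow> f x \<le> f z) \<and> (z \<le> x \<longrightarrow> f z \<le> f x)"
        using fa[OF \<open>\<not> L'\<close>] True by auto
    qed
  next
    case False
    then have zb: "z \<in> Z \<inter> {b..c}" using z noZ by force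
    then obtain w where w: "(z, w) \<in> \<Gamma>" "\<And>x y'. (x, y') \<in> \<Gamma> \<Longrightarrow> y' \<le> w \<Longrightarrow> (x \<le> z \<longrightarrow> f x \<le> f z) \<and> (z \<le> x \<longrightarrow> f z \<le> f x)"
      using \<Gamma>(5) unfolding exposed_below_def by blast
    show ?thesis unfolding exposed_below_def
    proof (intro exI[of _ "w / 3"] conjI[of "_ \<in> _"] allI impI)
      show "(z, w / 3) \<in> G" using w by (simp add: G_def mB)
      fix x v assume x: "(x, v) \<in> G" "v \<le> w / 3"
      have w1: "w \<le> 1" using r\<Gamma>[OF w(1)] by simp
      consider "(x, v) \<in> Va" | "(x, v) \<in> A" | "(x, v) \<in> Vb" | "(x, v) \<in> B" | "(x, v) \<in> Vc"
        using x(1) by (auto simp: G_def)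
      then show "(x \<le> z \<longrightarrow> f x \<le> f z) \<and> (z \<le> x \<longrightarrow> f z \<le> f x)"
      proof cases
        case 1 then show ?thesis using fa[of z] z zb \<open>a < b\<close> by (auto simp: mVa)
      next
        case 2 then show ?thesis using mA[OF 2] x(2) w1 by simp
      next
        case 3 then show ?thesis using fb[of z] zb by (auto simp: mVb)
      next
        case 4 then show ?thesis using w(2)[of x "3 * v"] x(2) by (simp add: mB)
      next
        case 5
        then have "w = 1" using x(2) w1 by (simp add: mVc)
        then show ?thesis using 5 top[of z] w(1) zb by (auto simp: mVc)
      qed
    qed
  qed
  moreover have "G \<subseteq> UNIV \<times> {0..1}" using mG by auto
  ultimately show ?thesis unfolding layout_def
    using path L'(1) R'(1)
    by (intro exI[of _ G] exI[of _ "if L' then 1 else 0"] exI[of _ "if R' then y / 3 else 1"]) auto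
qed

text \<open>Removability of the visors relative to a subinterval \<open>[p, q]\<close>: the triple has to lie in the
  subinterval, and the exceptions for the end points 0 and 1 are available only at free ends.\<close>

definition visors_removable :: "(real \<Rightarrow> real) \<Rightarrow> real set \<Rightarrow> bool \<Rightarrow> bool \<Rightarrow> real \<Rightarrow> real \<Rightarrow> bool" where
  "visors_removable f Z L R p q \<longleftrightarrow>
     (\<forall>z\<in>Z \<inter> {p..q}. \<forall>v\<in>{p..<z}. {v..<z} \<inter> Z = {} \<longrightarrow> f z < f v \<longrightarrow>
       (\<exists>a b c. p \<le> a \<and> a < v \<and> v < b \<and> z < c \<and> c \<le> q \<and> {a<..<b} \<inter> Z = {} \<and>
          ((L \<and> a = p \<and> p \<notin> Z) \<or> (\<forall>x\<in>{a..b}. f a \<le> f x)) \<and>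
          ((R \<and> c = q) \<or> (\<forall>x\<in>{a..b}. f x \<le> f c)) \<and> (\<forall>x\<in>{b..c}. f b \<le> f x)))"

lemma last_argmax:
  fixes f :: "real \<Rightarrow> real"
  assumes "continuous_on {u..w} f" "u \<le> w"
  obtains c where "c \<in> {u..w}" "\<And>x. x \<in> {u..w} \<Longrightarrow> f x \<le> f c" "\<And>x. x \<in> {c<..w} \<Longrightarrow> f x < f c"
proof -
  obtain m where m: "m \<in> {u..w}" "\<And>x. x \<in> {u..w} \<Longrightarrow> f x \<le> f m"
    using continuous_attains_sup[OF compact_Icc _ assms(1)] assms(2) by auto
  have "closedin (top_of_set {u..w}) ({u..w} \<inter> f -` {f m..})"
    by (rule continuous_closedin_preimage[OF assms(1)]) auto
  then have "compact ({u..w} \<inter> f -` {f m..})" using closedin_compact compact_Icc by blast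
  then obtain c where c: "c \<in> {u..w} \<inter> f -` {f m..}" "\<And>x. x \<in> {u..w} \<inter> f -` {f m..} \<Longrightarrow> x \<le> c"
    using compact_attains_sup[of "{u..w} \<inter> f -` {f m..}"] m by blast
  show ?thesis
  proof (rule that[of c])
    show "f x \<le> f c" if "x \<in> {u..w}" for x using m(2)[OF that] c(1) by auto
    show "f x < f c" if "x \<in> {c<..w}" for x
    proof (rule ccontr)
      assume "\<not> f x < f c"
      then have "x \<in> {u..w} \<inter> f -` {f m..}" using that c(1) by auto
      then show False using c(2)[of x] that by auto
    qed
  qed (use c in auto)
qed

lemma first_argmin:
  fixes f :: "real \<Rightarrow> real"
  assumes "continuous_on {u..w} f" "u \<le> w"
  obtains c where "c \<in> {u..w}" "\<And>x. x \<in> {u..w} \<Longrightarrow> f c \<le> f x" "\<And>x. x \<in> {u..<c} \<Longrightarrow> f c < f x"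
proof -
  have "continuous_on {-w..-u} (\<lambda>x. - f (- x))"
    by (intro continuous_intros continuous_on_compose2[OF assms(1)]) auto
  moreover have "- w \<le> - u" using assms(2) by simp
  ultimately obtain c where c: "c \<in> {-w..-u}" "\<And>x. x \<in> {-w..-u} \<Longrightarrow> - f (- x) \<le> - f (- c)"
    "\<And>x. x \<in> {c<..-u} \<Longrightarrow> - f (- x) < - f (- c)"
    using last_argmax[of "-w" "-u" "\<lambda>x. - f (- x)"] by blast
  show ?thesis
  proof (rule that[of "- c"])
    show "f (- c) \<le> f x" if "x \<in> {u..w}" for x using c(2)[of "- x"] that by auto
    show "f (- c) < f x" if "x \<in> {u..<- c}" for x using c(3)[of "- x"] that by auto
  qed (use c in auto)
qed

lemma longest_stay_above:
  fixes f :: "real \<Rightarrow> real"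
  assumes "continuous_on {b..q} f" "b \<le> q"
  obtains C where "C \<in> {b..q}" "\<And>x. x \<in> {b..C} \<Longrightarrow> f b \<le> f x"
    "\<And>y. y \<in> {b..q} \<Longrightarrow> (\<And>x. x \<in> {b..y} \<Longrightarrow> f b \<le> f x) \<Longrightarrow> y \<le> C"
proof -
  define S where "S = {y \<in> {b..q}. \<forall>x\<in>{b..y}. f b \<le> f x}"
  have bS: "b \<in> S" using assms by (auto simp: S_def)
  have bdd: "bdd_above S" by (rule bdd_aboveI[of _ q]) (auto simp: S_def)
  have Cq: "Sup S \<le> q" "b \<le> Sup S"
  proof -
    show "Sup S \<le> q" by (rule cSup_least) (use bS in \<open>auto simp: S_def\<close>)
    show "b \<le> Sup S" by (rule cSup_upper[OF bS bdd])
  qed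
  have below: "f b \<le> f x" if "x \<in> {b..<Sup S}" for x
  proof -
    have "x < Sup S" "S \<noteq> {}" using that bS by auto
    then obtain y where "y \<in> S" "x < y" using less_cSup_iff[OF _ bdd, of x] by blast
    then show ?thesis using that by (auto simp: S_def)
  qed
  show ?thesis
  proof (rule that[of "Sup S"])
    show "f b \<le> f x" if x: "x \<in> {b..Sup S}" for x
    proof (cases "b < Sup S")
      case True
      have "closure {b..<Sup S} = {b..Sup S}" using True by simp
      moreover have "continuous_on {b..Sup S} f" using Cq by (intro continuous_on_subset[OF assms(1)]) auto
      ultimately show ?thesis
        using continuous_ge_on_closure[of "{b..<Sup S}" f x "f b"] below x by auto
    next
      case False
      then have "x = b" using x by auto
      then show ?thesis by simp
    qed
    show "y \<le> Sup S" if "y \<in> {b..q}" "\<And>x. x \<in> {b..y} \<Longrightarrow> f b \<le> f x" for y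
      by (rule cSup_upper[OF _ bdd]) (use that in \<open>auto simp: S_def\<close>)
  qed (use Cq in auto)
qed

section \<open>Existence of layouts\<close>

lemma visors_removableE:
  assumes "visors_removable f Z L R p q" "z \<in> Z \<inter> {p..q}" "v \<in> {p..<z}" "{v..<z} \<inter> Z = {}" "f z < f v"
  obtains a b c where "p \<le> a" "a < v" "v < b" "z < c" "c \<le> q" "{a<..<b} \<inter> Z = {}"
    "(L \<and> a = p \<and> p \<notin> Z) \<or> (\<forall>x\<in>{a..b}. f a \<le> f x)"
    "(R \<and> c = q) \<or> (\<forall>x\<in>{a..b}. f x \<le> f c)" "\<forall>x\<in>{b..c}. f b \<le> f x"
proof -
  have "\<exists>a b c. p \<le> a \<and> a < v \<and> v < b \<and> z < c \<and> c \<le> q \<and> {a<..<b} \<inter> Z = {} \<and>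
      ((L \<and> a = p \<and> p \<notin> Z) \<or> (\<forall>x\<in>{a..b}. f a \<le> f x)) \<and>
      ((R \<and> c = q) \<or> (\<forall>x\<in>{a..b}. f x \<le> f c)) \<and> (\<forall>x\<in>{b..c}. f b \<le> f x)"
    using assms(1)[unfolded visors_removable_def, rule_format, OF assms(2-5)] .
  then show ?thesis by (elim exE conjE) (rule that; assumption)
qed

lemma outside_gap: "{a<..<b} \<inter> Z = {} \<Longrightarrow> y \<in> Z \<Longrightarrow> y \<le> a \<or> b \<le> (y::real)"
  by (meson disjoint_iff greaterThanLessThan_iff not_le)

text \<open>Induction on the number of breakpoints. If there is a visor, let \<open>z\<close> be the first marked point that
  has one, let \<open>v\<close> be a highest visor for \<open>z\<close> and choose a triple that removes it. Unless a
  free end of the interval serves as \<open>a\<close> or \<open>c\<close>, these outer points can be improved to canonical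
  ones: \<open>a\<close> becomes the first minimum between the preceding marked point
  (or \<open>p\<close>) and \<open>b\<close>, and \<open>c\<close> becomes the last maximum on the longest interval \<open>[b, C]\<close> on which \<open>f\<close> stays
  above \<open>f b\<close>. These choices prevent triples from crossing: visors in \<open>[b, c]\<close> have
  triples in \<open>[b, c]\<close>, visors after \<open>c\<close> have triples after \<open>c\<close>, and no earlier point obstructs a
  marked point of a later block. So the three blocks can be treated separately: \<open>[p, a]\<close> has
  no visor, \<open>[a, c]\<close> is flipped over a layout of \<open>[b, c]\<close>, and \<open>[c, q]\<close> is stacked on top. Since
  \<open>[a, b]\<close> contains the visor, it contains a breakpoint, so the last two intervals have fewer of them.\<close>

theorem layout_exists:
  fixes f :: "real \<Rightarrow> real"
  assumes contf: "continuous_on {0..1} f" and finZ: "finite Z" and fZ: "strict_mono_on Z f"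
    and finE: "finite E"
    and breaks: "\<And>x y v. 0 \<le> x \<Longrightarrow> x < y \<Longrightarrow> y \<le> 1 \<Longrightarrow> {x<..<y} \<inter> E = {} \<Longrightarrow> v \<in> {x..y} \<Longrightarrow>
      f v \<le> max (f x) (f y)"
  shows "0 \<le> p \<Longrightarrow> p < q \<Longrightarrow> q \<le> 1 \<Longrightarrow> (L \<Longrightarrow> p \<in> E) \<Longrightarrow> visors_removable f Z L R p q \<Longrightarrow>
    layout f Z L R p q"
proof (induction "card (E \<inter> {p..<q})" arbitrary: p q L R rule: less_induct)
  case less
  note p0 = \<open>0 \<le> p\<close> and pq = \<open>p < q\<close> and q1 = \<open>q \<le> 1\<close> and LE = less.prems(4)
  have cont: "continuous_on {u..w} f" if "p \<le> u" "w \<le> q" for u w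
    using that p0 q1 by (intro continuous_on_subset[OF contf]) auto
  have mono: "f x \<le> f y" if "x \<in> Z" "y \<in> Z" "x \<le> y" for x y
    using strict_mono_onD[OF fZ, of x y] that by (cases "x = y") auto
  have smono: "f x < f y" if "x \<in> Z" "y \<in> Z" "x < y" for x y
    using strict_mono_onD[OF fZ] that by blast
  define W where "W = {z \<in> Z \<inter> {p..q}. \<exists>v\<in>{p..<z}. f z < f v}"
  show ?case
  proof (cases "W = {}")
    case True
    show ?thesis
    proof (rule layout_of_no_visor[OF pq])
      fix z x assume z: "z \<in> Z \<inter> {p..q}" and x: "x \<in> {p..z}"
      then have "z \<notin> W" using True by blast
      then show "f x \<le> f z" using z x by (cases "x = z") (force simp: W_def)+
    qed
  next
    case False
    have finW: "finite W" using finZ by (auto simp: W_def)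
    define z where "z = Min W"
    have zW: "z \<in> W" using Min_in[OF finW False] by (simp add: z_def)
    have zmin: "z \<le> y" if "y \<in> W" for y using Min_le[OF finW that] by (simp add: z_def)
    have zZ: "z \<in> Z" "p \<le> z" "z \<le> q" using zW by (auto simp: W_def)
    have early: "f x \<le> f y" if "y \<in> Z" "y < z" "p \<le> x" "x \<le> y" for x y
    proof (cases "x = y")
      case False
      have "y \<notin> W" using zmin that by force
      then show ?thesis using that zZ False by (force simp: W_def)
    qed simp
    obtain v0 where v0: "v0 \<in> {p..<z}" "f z < f v0" using zW by (auto simp: W_def)
    define l where "l = Max (insert p (Z \<inter> {p..<z}))"
    have finl: "finite (insert p (Z \<inter> {p..<z}))" using finZ by simp
    have l: "l = p \<or> l \<in> Z" "p \<le> l" "l < z"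
    proof -
      have "l \<in> insert p (Z \<inter> {p..<z})" unfolding l_def by (rule Max_in[OF finl]) simp
      moreover have "p < z" using v0 by auto
      ultimately show "l = p \<or> l \<in> Z" "p \<le> l" "l < z" by auto
    qed
    have lmax: "y \<le> l" if "y \<in> Z" "p \<le> y" "y < z" for y
      unfolding l_def by (rule Max_ge[OF finl]) (use that in auto)
    have before_l: "f x < f z" if "p \<le> x" "x < l \<or> (x = l \<and> l \<in> Z)" for x
    proof -
      have "l \<in> Z" using that l(1) by auto
      then have "f x \<le> f l" "f l < f z" using early[of l x] smono[OF _ zZ(1)] l(3) that by auto
      then show ?thesis by simp
    qed
    obtain v where v: "v \<in> {l..z}" "\<And>x. x \<in> {l..z} \<Longrightarrow> f x \<le> f v"
      using last_argmax[OF cont[of l z]] l zZ by (metis less_imp_le)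
    have "v0 \<ge> l" using before_l[of v0] v0 by force
    then have fv: "f z < f v" using v(2)[of v0] v0 by auto
    then have "v \<noteq> z" by auto
    have vis_free: "{x..<z} \<inter> Z = {}" if "l \<le> x" "f z < f x" for x
    proof (rule ccontr)
      assume "{x..<z} \<inter> Z \<noteq> {}"
      then obtain y where y: "y \<in> Z" "x \<le> y" "y < z" by auto
      then have "y \<le> l" using lmax[of y] that l(2) by auto
      then have "y = l" "x = l" using y that by auto
      then have "x = l" "l \<in> Z" using y by auto
      then show False using before_l[of x] l(2) that by auto
    qed
    have triple: "\<exists>a b c. l \<le> a \<and> a < x \<and> x < b \<and> b \<le> z \<and> z < c \<and> c \<le> q \<and> {a<..<b} \<inter> Z = {} \<and>
          ((L \<and> a = p \<and> p \<notin> Z) \<or> (\<forall>x\<in>{a..b}. f a \<le> f x)) \<and>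
          ((R \<and> c = q) \<or> (\<forall>x\<in>{a..b}. f x \<le> f c)) \<and> (\<forall>x\<in>{b..c}. f b \<le> f x)"
      if x: "l \<le> x" "x < z" "f z < f x" for x
    proof -
      have "x \<in> {p..<z}" "z \<in> Z \<inter> {p..q}" using x l zZ by auto
      then obtain a b c where abc: "p \<le> a" "a < x" "x < b" "z < c" "c \<le> q" "{a<..<b} \<inter> Z = {}"
        "(L \<and> a = p \<and> p \<notin> Z) \<or> (\<forall>x\<in>{a..b}. f a \<le> f x)"
        "(R \<and> c = q) \<or> (\<forall>x\<in>{a..b}. f x \<le> f c)" "\<forall>x\<in>{b..c}. f b \<le> f x"
        using visors_removableE[OF less.prems(5) _ _ vis_free[OF x(1,3)] x(3)] by metis
      have "l \<noteq> x" if "l \<in> Z" using before_l[of l] that l x by auto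
      have "l \<le> a"
      proof (cases "l \<in> Z")
        case True
        then show ?thesis using outside_gap[OF abc(6) True] abc(3) x(1) by auto
      qed (use l abc in auto)
      moreover have "b \<le> z" using outside_gap[OF abc(6) zZ(1)] abc(2) x(2) by auto
      ultimately show ?thesis using abc by (intro exI[of _ a] exI[of _ b] exI[of _ c]) auto
    qed
    obtain a0 b c0 where t: "l \<le> a0" "a0 < v" "v < b" "b \<le> z" "z < c0" "c0 \<le> q" "{a0<..<b} \<inter> Z = {}"
        "(L \<and> a0 = p \<and> p \<notin> Z) \<or> (\<forall>x\<in>{a0..b}. f a0 \<le> f x)"
        "(R \<and> c0 = q) \<or> (\<forall>x\<in>{a0..b}. f x \<le> f c0)" "\<And>x. x \<in> {b..c0} \<Longrightarrow> f b \<le> f x"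
      using triple[of v] v(1) fv \<open>v \<noteq> z\<close> by (metis atLeastAtMost_iff le_neq_trans)
    have fbz: "f b \<le> f z" using t by auto
    have lb: "l < b" "p < b" "b \<le> q" using t l zZ by auto
    define free where "free \<longleftrightarrow> L \<and> l = p \<and> p \<notin> Z"
    obtain m where m: "m \<in> {l..b}" "\<And>x. x \<in> {l..b} \<Longrightarrow> f m \<le> f x" "\<And>x. x \<in> {l..<m} \<Longrightarrow> f m < f x"
      using first_argmin[OF cont[of l b]] lb l by (metis less_imp_le)
    define a where "a = (if free then p else m)"
    have tight: "\<forall>x\<in>{a'..b'}. f a' \<le> f x" if "\<not> free" "l \<le> a'"
      "(L \<and> a' = p \<and> p \<notin> Z) \<or> (\<forall>x\<in>{a'..b'}. f a' \<le> f x)" for a' b'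
      using that l by (auto simp: free_def)
    have av: "l \<le> a" "a < v" "a < b"
    proof -
      show "l \<le> a" using m(1) by (auto simp: a_def free_def)
      show "a < v"
      proof (cases free)
        case False
        have "\<not> a0 < m"
        proof
          assume "a0 < m"
          then have "f m < f a0" using m(3)[of a0] t(1) by auto
          moreover have "f a0 \<le> f m" using tight[OF False t(1,8)] m(1) \<open>a0 < m\<close> by auto
          ultimately show False by simp
        qed
        then show ?thesis using False t by (simp add: a_def)
      qed (use t l in \<open>simp add: a_def free_def\<close>)
      then show "a < b" using t by simp
    qed
    have pa: "p \<le> a" using av l by simp
    have fa: "f a \<le> f x" if "\<not> free" "x \<in> {a..b}" for x
      using that m(2)[of x] av by (auto simp: a_def)
    have noZ: "Z \<inter> {a<..<b} = {}"
    proof -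
      have "y \<le> l" if "y \<in> Z" "a < y" "y < b" for y using lmax[of y] that t pa by auto
      then show ?thesis using av by force
    qed
    \<comment> \<open>A visor for \<open>z\<close> before \<open>a\<close> would have a triple that starts with a value at most the minimum
      \<open>f a\<close>, contrary to the choice of \<open>a\<close> as the first minimum.\<close>
    have upto_a: "f x \<le> f z" if "p \<le> x" "x \<le> a" "p < a" for x
    proof (cases "x < l \<or> x = a")
      case True
      have "\<not> free" using that by (auto simp: a_def)
      then show ?thesis using True before_l[of x] fa[of b] av fbz that by force
    next
      case False
      have nf: "\<not> free" using that by (auto simp: a_def)
      then have am: "a = m" by (simp add: a_def)
      show ?thesis
      proof (rule ccontr)
        assume "\<not> f x \<le> f z"
        then have "l \<le> x" "x < z" "f z < f x" using False that av t by auto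
        from triple[OF this]
        obtain a' b' c' where t': "l \<le> a'" "a' < x" "x < b'" "b' \<le> z" "z < c'"
          "(L \<and> a' = p \<and> p \<notin> Z) \<or> (\<forall>x\<in>{a'..b'}. f a' \<le> f x)" "\<forall>x\<in>{b'..c'}. f b' \<le> f x"
          by metis
        have t6: "\<forall>x\<in>{a'..b'}. f a' \<le> f x" using tight[OF nf t'(1,6)] .
        have "f a' \<le> f m"
        proof (cases "m \<le> b'")
          case True
          then show ?thesis using t6 t' that am by auto
        next
          case False
          have "f a' \<le> f b'" using t6 t' by auto
          moreover have "f b' \<le> f m" using t'(5,7) False m(1) t(4) by auto
          ultimately show ?thesis by simp
        qed
        moreover have "f m < f a'" using m(3)[of a'] t' that am by auto
        ultimately show False by simp
      qed
    qed
    obtain C where C: "C \<in> {b..q}" "\<And>x. x \<in> {b..C} \<Longrightarrow> f b \<le> f x"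
      "\<And>y. y \<in> {b..q} \<Longrightarrow> (\<And>x. x \<in> {b..y} \<Longrightarrow> f b \<le> f x) \<Longrightarrow> y \<le> C"
      using longest_stay_above[OF cont[of b q]] lb by (metis less_imp_le order_refl)
    have c0C: "c0 \<le> C" using C(3)[of c0] t by auto
    obtain k where k: "k \<in> {b..C}" "\<And>x. x \<in> {b..C} \<Longrightarrow> f x \<le> f k" "\<And>x. x \<in> {k<..C} \<Longrightarrow> f x < f k"
      using last_argmax[OF cont[of b C]] C(1) lb by (metis atLeastAtMost_iff less_imp_le)
    define R' where "R' \<longleftrightarrow> R \<and> C = q"
    define c where "c = (if R' then q else k)"
    have kc0: "\<not> R' \<Longrightarrow> \<forall>x\<in>{a0..b}. f x \<le> f c0"
      using t(6,9) c0C C(1) by (auto simp: R'_def)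
    have zc: "z < c" and cC: "c \<in> {b..C}"
    proof -
      have "z < k" if "\<not> R'"
      proof (rule ccontr)
        assume "\<not> z < k"
        then have "f k \<le> f v" using v(2)[of k] k(1) lb by auto
        also have "f v \<le> f c0" using kc0[OF that] t by auto
        also have "f c0 < f k" using k(3)[of c0] \<open>\<not> z < k\<close> t(5) c0C by auto
        finally show False by simp
      qed
      then show "z < c" using t by (auto simp: c_def)
      show "c \<in> {b..C}" using k(1) C(1) by (auto simp: c_def R'_def)
    qed
    have cmax: "f x \<le> f c" if "\<not> R'" "x \<in> {a..C}" for x
    proof (cases "x \<le> b")
      case True
      then have "f x \<le> f v" using v(2)[of x] that av t by auto
      also have "f v \<le> f c0" using kc0[OF that(1)] t by auto
      also have "f c0 \<le> f k" using k(2)[of c0] c0C t by auto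
      finally show ?thesis using that by (simp add: c_def)
    qed (use that k(2)[of x] in \<open>auto simp: c_def\<close>)
    have clast: "f x < f c" if "\<not> R'" "x \<in> {c<..C}" for x
      using that k(3)[of x] by (auto simp: c_def)
    have bc: "b < c" using zc t by simp
    have cq: "c \<le> q" using cC C(1) by auto
    have Rc: "c = q" if R' using that by (simp add: c_def)
    have fb: "f b \<le> f x" if "x \<in> {b..c}" for x using C(2)[of x] that cC by auto
    have stay: "y \<le> C" if "y \<in> {b..q}" "\<And>x. x \<in> {b..y} \<Longrightarrow> f b \<le> f x" for y using C(3) that by blast
    \<comment> \<open>A visor in \<open>(a, b)\<close> above both \<open>f a\<close> and \<open>f b\<close> forces a breakpoint; at a free left end the
      breakpoint is \<open>a\<close> itself.\<close>
    have "E \<inter> {a..<b} \<noteq> {}"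
    proof
      assume E0: "E \<inter> {a..<b} = {}"
      then have "{a<..<b} \<inter> E = {}" by auto
      then have "f v \<le> max (f a) (f b)" using breaks[of a b v] pa p0 av t lb q1 by auto
      then have "f v \<le> f a" using fbz fv by auto
      have "free" using fa[of b] \<open>f v \<le> f a\<close> av fbz fv by force
      then have "a \<in> E" using LE by (auto simp: a_def free_def)
      then show False using E0 av by auto
    qed
    then obtain e where e: "e \<in> E" "a \<le> e" "e < b" by auto
    have card_less: "card (E \<inter> {p'..<q'}) < card (E \<inter> {p..<q})" if "b \<le> p'" "q' \<le> q" for p' q'
    proof (rule psubset_card_mono)
      have "e \<in> E \<inter> {p..<q}" "e \<notin> E \<inter> {p'..<q'}" using e pa lb that by auto
      moreover have "E \<inter> {p'..<q'} \<subseteq> E \<inter> {p..<q}" using that lb by auto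
      ultimately show "E \<inter> {p'..<q'} \<subset> E \<inter> {p..<q}" by blast
    qed (use finE in simp)
    have layB: "layout f Z False R' b c"
    proof (rule less.hyps)
      show "card (E \<inter> {b..<c}) < card (E \<inter> {p..<q})" using card_less cq by simp
      show "0 \<le> b" "b < c" "c \<le> 1" using lb p0 bc cq q1 by auto
      show "visors_removable f Z False R' b c" unfolding visors_removable_def
      proof (intro ballI impI)
        fix z' v' assume z': "z' \<in> Z \<inter> {b..c}" and v': "v' \<in> {b..<z'}" "{v'..<z'} \<inter> Z = {}" "f z' < f v'"
        have "z' \<in> Z \<inter> {p..q}" "v' \<in> {p..<z'}" using z' v' lb cq by auto
        then obtain a' b' c' where t': "p \<le> a'" "a' < v'" "v' < b'" "z' < c'" "c' \<le> q" "{a'<..<b'} \<inter> Z = {}"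
          "(L \<and> a' = p \<and> p \<notin> Z) \<or> (\<forall>x\<in>{a'..b'}. f a' \<le> f x)"
          "(R \<and> c' = q) \<or> (\<forall>x\<in>{a'..b'}. f x \<le> f c')" "\<forall>x\<in>{b'..c'}. f b' \<le> f x"
          using visors_removableE[OF less.prems(5) _ _ v'(2,3)] by metis
        have b'z: "b' \<le> z'" using outside_gap[OF t'(6), of z'] t'(2) z' v' by auto
        have bv: "b < v'"
        proof (rule ccontr)
          assume "\<not> b < v'"
          then have "v' = b" using v' by auto
          then show False using fb[of z'] z' v' by auto
        qed
        \<comment> \<open>Truncating the triple to \<open>[b, c]\<close> is harmless, because \<open>f b\<close> is minimal there and, if the
          triple extends beyond \<open>c\<close>, then \<open>f c\<close> is maximal there.\<close>
        define a'' where "a'' = max a' b"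
        define c'' where "c'' = min c' c"
        have i3: "\<forall>x\<in>{a''..b'}. f a'' \<le> f x"
        proof (cases "a' \<le> b")
          case True
          then show ?thesis using fb b'z z' by (auto simp: a''_def)
        next
          case False
          then show ?thesis using t'(7) lb by (auto simp: a''_def)
        qed
        have sub: "x \<in> {a..C}" if "x \<in> {a''..b'}" for x
          using that b'z z' av cC by (auto simp: a''_def)
        have i4: "(R' \<and> c'' = c) \<or> (\<forall>x\<in>{a''..b'}. f x \<le> f c'')"
        proof (cases "R' \<or> c < c'")
          case True
          show ?thesis
          proof (cases R')
            case True
            show ?thesis
            proof (cases "c' = q")
              case False
              then have "c'' = c'" using t' Rc[OF True] by (simp add: c''_def)
              then show ?thesis using t'(8) False by (auto simp: a''_def)
            qed (use True Rc in \<open>auto simp: c''_def\<close>)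
          next
            case False
            then show ?thesis using True cmax[OF False sub] by (auto simp: c''_def)
          qed
        next
          case False
          then have c'': "c'' = c'" by (simp add: c''_def)
          show ?thesis
          proof (cases "R \<and> c' = q")
            case True
            then have "C = q" using False C(1) cC t' by auto
            then show ?thesis using True False by (simp add: R'_def)
          next
            case False
            then show ?thesis using t'(8) by (auto simp: c'' a''_def)
          qed
        qed
        have "z' < c''"
        proof (cases "c < c'")
          case True
          then have "\<not> R'" using Rc t' by auto
          have "f v' \<le> f c" by (rule cmax[OF \<open>\<not> R'\<close> sub]) (use t' bv in \<open>auto simp: a''_def\<close>)
          then have "z' \<noteq> c" using v' by auto
          then show ?thesis using True z' by (auto simp: c''_def)
        qed (use t' in \<open>auto simp: c''_def\<close>)
        moreover have "b \<le> a''" "a'' < v'" "c'' \<le> c" using t' bv by (auto simp: a''_def c''_def)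
        moreover have "{a''<..<b'} \<inter> Z = {}" using t'(6) by (force simp: a''_def)
        moreover have "\<forall>x\<in>{b'..c''}. f b' \<le> f x" using t'(9) by (simp add: c''_def)
        ultimately show "\<exists>a b'' c'. b \<le> a \<and> a < v' \<and> v' < b'' \<and> z' < c' \<and> c' \<le> c \<and> {a<..<b''} \<inter> Z = {} \<and>
          ((False \<and> a = b \<and> b \<notin> Z) \<or> (\<forall>x\<in>{a..b''}. f a \<le> f x)) \<and>
          ((R' \<and> c' = c) \<or> (\<forall>x\<in>{a..b''}. f x \<le> f c')) \<and> (\<forall>x\<in>{b''..c'}. f b'' \<le> f x)"
          using t'(3) i3 i4 by (intro exI[of _ a''] exI[of _ b'] exI[of _ c'']) simp
      qed
    qed simp
    have flip: "layout f Z L'' R'' a c" if L'': "free \<Longrightarrow> L''" and R'': "R' \<Longrightarrow> R''" for L'' R''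
    proof (rule layout_flip[OF av(3) layB noZ, where L' = free])
      show "L'' \<and> a \<notin> Z" if free using that L'' by (simp add: a_def free_def)
      show "f a \<le> f x" if "\<not> free" "x \<in> {a..b}" for x using fa that by blast
      show "R''" if R' using R'' that .
      show "f x \<le> f c" if "\<not> R'" "x \<in> {a..b}" for x using cmax[OF that(1), of x] that(2) C(1) by auto
      show "f b \<le> f x" if "x \<in> {b..c}" for x using fb that .
    qed
    have right: "layout f Z L'' R a q" if "free \<Longrightarrow> L''" for L''
    proof (cases "c = q")
      case True
      then show ?thesis using flip[of L'' R] that by (auto simp: R'_def)
    next
      case False
      then have "c < q" "\<not> R'" using cq Rc by auto
      have beyond: "\<exists>a' b' c'. c' \<le> q \<and> z \<le> a' \<and> a' < x \<and> x < b' \<and> y < c' \<and> {a'<..<b'} \<inter> Z = {} \<and>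
          (\<forall>x\<in>{a'..b'}. f a' \<le> f x) \<and>
          ((R \<and> c' = q) \<or> (\<forall>x\<in>{a'..b'}. f x \<le> f c')) \<and> (\<forall>x\<in>{b'..c'}. f b' \<le> f x)"
        if y: "y \<in> Z" "y \<le> q" and x: "c \<le> x" "x < y" "{x..<y} \<inter> Z = {}" "f y < f x" for x y
      proof -
        have "y \<in> Z \<inter> {p..q}" "x \<in> {p..<y}" using x y bc lb by auto
        then obtain a' b' c' where t': "p \<le> a'" "a' < x" "x < b'" "y < c'" "c' \<le> q" "{a'<..<b'} \<inter> Z = {}"
          "(L \<and> a' = p \<and> p \<notin> Z) \<or> (\<forall>x\<in>{a'..b'}. f a' \<le> f x)"
          "(R \<and> c' = q) \<or> (\<forall>x\<in>{a'..b'}. f x \<le> f c')" "\<forall>x\<in>{b'..c'}. f b' \<le> f x"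
          using visors_removableE[OF less.prems(5) _ _ x(3,4)] by metis
        have "z \<le> a'" using outside_gap[OF t'(6) zZ(1)] t'(2,3) zc x(1) by auto
        moreover have "a' \<noteq> p" using \<open>z \<le> a'\<close> v0 by auto
        ultimately show ?thesis using t' by (intro exI[of _ a'] exI[of _ b'] exI[of _ c']) simp
      qed
      have within: "b' \<le> C" if "a' \<in> {b..c}" "a' \<le> b'" "b' \<le> q" "\<forall>x\<in>{a'..b'}. f a' \<le> f x" for a' b'
      proof (rule stay)
        show "b' \<in> {b..q}" using that by auto
        fix x assume "x \<in> {b..b'}"
        show "f b \<le> f x"
        proof (cases "x \<le> c")
          case True
          then show ?thesis using fb[of x] \<open>x \<in> {b..b'}\<close> by simp
        next
          case False
          then have "x \<in> {a'..b'}" using \<open>x \<in> {b..b'}\<close> that(1) by simp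
          then show ?thesis using that(4) fb[OF that(1)] by force
        qed
      qed
      \<comment> \<open>Otherwise \<open>c\<close> would be a visor for the next marked point. A triple removing it starts inside
        \<open>[b, c]\<close>, so it is confined to \<open>[b, C]\<close>, where nothing after \<open>c\<close> is as high as \<open>f c\<close>.\<close>
      have above_c: "f c \<le> f z'" if z': "z' \<in> Z" "c < z'" "z' \<le> q" for z'
      proof (rule ccontr)
        assume "\<not> f c \<le> f z'"
        define y where "y = Min (Z \<inter> {c<..q})"
        have fin: "finite (Z \<inter> {c<..q})" using finZ by simp
        have y: "y \<in> Z \<inter> {c<..q}" unfolding y_def by (rule Min_in[OF fin]) (use z' in auto)
        have ymin: "y \<le> x" if "x \<in> Z" "c < x" "x \<le> q" for x
          unfolding y_def by (rule Min_le[OF fin]) (use that in auto)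
        have fy: "f y < f c" using mono[of y z'] ymin[of z'] y z' \<open>\<not> f c \<le> f z'\<close> by auto
        have "{c..<y} \<inter> Z = {}"
        proof (rule ccontr)
          assume "{c..<y} \<inter> Z \<noteq> {}"
          then obtain x where x: "x \<in> Z" "c \<le> x" "x < y" by auto
          then have "x = c" using ymin[of x] y by force
          then show False using smono[of x y] x y fy by auto
        qed
        then obtain a' b' c' where t': "c' \<le> q" "z \<le> a'" "a' < c" "c < b'" "y < c'" "{a'<..<b'} \<inter> Z = {}"
          "\<forall>x\<in>{a'..b'}. f a' \<le> f x"
          "(R \<and> c' = q) \<or> (\<forall>x\<in>{a'..b'}. f x \<le> f c')" "\<forall>x\<in>{b'..c'}. f b' \<le> f x"
          using beyond[of y c] y fy by auto
        have "b' \<le> y" using outside_gap[OF t'(6), of y] t'(3) y by auto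
        have a'b: "a' \<in> {b..c}" using t' t by auto
        have "c' \<le> C"
        proof (rule within[OF a'b])
          have "f a' \<le> f b'" using t' by auto
          show "\<forall>x\<in>{a'..c'}. f a' \<le> f x"
          proof
            fix x assume x: "x \<in> {a'..c'}"
            show "f a' \<le> f x"
            proof (cases "x \<le> b'")
              case False
              then have "f b' \<le> f x" using t'(9) x by simp
              then show ?thesis using \<open>f a' \<le> f b'\<close> by simp
            qed (use t'(7) x in simp)
          qed
        qed (use t' y in auto)
        then have "f c' < f c" using clast[OF \<open>\<not> R'\<close>, of c'] t' y by auto
        moreover have "\<not> (R \<and> c' = q)" using \<open>c' \<le> C\<close> C(1) \<open>\<not> R'\<close> by (auto simp: R'_def)
        moreover have "c \<in> {a'..b'}" using t'(3,4) by simp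
        ultimately have "f c' < f c" "f c \<le> f c'" using t'(8) by blast+
        then show False by simp
      qed
      have "layout f Z False R c q"
      proof (rule less.hyps)
        show "card (E \<inter> {c..<q}) < card (E \<inter> {p..<q})" using card_less bc by simp
        show "0 \<le> c" "c < q" "q \<le> 1" using lb p0 bc \<open>c < q\<close> q1 by auto
        show "visors_removable f Z False R c q" unfolding visors_removable_def
        proof (intro ballI impI)
          fix z' v' assume z': "z' \<in> Z \<inter> {c..q}" and v': "v' \<in> {c..<z'}" "{v'..<z'} \<inter> Z = {}" "f z' < f v'"
          obtain a' b' c' where t': "c' \<le> q" "z \<le> a'" "a' < v'" "v' < b'" "z' < c'" "{a'<..<b'} \<inter> Z = {}"
            "\<forall>x\<in>{a'..b'}. f a' \<le> f x"
            "(R \<and> c' = q) \<or> (\<forall>x\<in>{a'..b'}. f x \<le> f c')" "\<forall>x\<in>{b'..c'}. f b' \<le> f x"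
            using beyond[of z' v'] z' v' by auto
          have "f c < f v'" using above_c[of z'] z' v' by auto
          moreover have "a \<le> v'" using v' bc av by simp
          ultimately have "C < v'" using cmax[OF \<open>\<not> R'\<close>, of v'] by (cases "v' \<le> C") auto
          have "b' \<le> z'" using outside_gap[OF t'(6), of z'] t'(3) z' v' by auto
          have "c \<le> a'"
          proof (rule ccontr)
            assume "\<not> c \<le> a'"
            then have "a' \<in> {b..c}" using t' t by auto
            then have "b' \<le> C" using within t' z' \<open>b' \<le> z'\<close> by auto
            then show False using t' \<open>C < v'\<close> by auto
          qed
          then show "\<exists>a b c'. c \<le> a \<and> a < v' \<and> v' < b \<and> z' < c' \<and> c' \<le> q \<and> {a<..<b} \<inter> Z = {} \<and>
            ((False \<and> a = c \<and> c \<notin> Z) \<or> (\<forall>x\<in>{a..b}. f a \<le> f x)) \<and>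
            ((R \<and> c' = q) \<or> (\<forall>x\<in>{a..b}. f x \<le> f c')) \<and> (\<forall>x\<in>{b..c'}. f b \<le> f x)"
            using t' by (intro exI[of _ a'] exI[of _ b'] exI[of _ c']) simp
        qed
      qed simp
      moreover have "layout f Z L'' False a c" using flip[of L'' False] that \<open>\<not> R'\<close> by auto
      moreover have "f x \<le> f z'" if "z' \<in> Z \<inter> {c..q}" "x \<in> {a..c}" for z' x
      proof -
        have "f x \<le> f c" using cmax[OF \<open>\<not> R'\<close>, of x] that cC by auto
        then show ?thesis using above_c[of z'] that by (cases "z' = c") auto
      qed
      ultimately show ?thesis by (intro layout_stack[of f Z L'' a c R q])
    qed
    show ?thesis
    proof (cases "p = a")
      case True
      then show ?thesis using right[of L] by (auto simp: free_def)
    next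
      case False
      then have "p < a" using pa by simp
      then have "\<not> free" by (auto simp: a_def)
      show ?thesis
      proof (rule layout_stack)
        show "layout f Z L False p a"
          by (rule layout_of_no_visor[OF \<open>p < a\<close>]) (use early t av in auto)
        show "layout f Z False R a q" using right \<open>\<not> free\<close> by blast
        fix z' x assume z': "z' \<in> Z \<inter> {a..q}" and x: "x \<in> {p..a}"
        show "f x \<le> f z'"
        proof (cases "z' < z")
          case True
          then have "z' \<le> l" using lmax[of z'] z' pa by auto
          then have "z' = a" using z' av by auto
          then show ?thesis using early[of z' x] z' x True by auto
        next
          case False
          then show ?thesis using upto_a[of x] mono[OF zZ(1), of z'] z' x \<open>p < a\<close> by auto
        qed
      qed
    qed
  qed
qed

section \<open>Bending the plane along an interval map\<close>

text \<open>A planar map that approximates \<open>f\<close> on the segment \<open>[0, 1] \<times> {0}\<close> and carries the vertical ray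
  below each marked point \<open>z\<close> to the one below \<open>f z\<close>, up to an error of size \<open>\<epsilon>\<close> near its end.
  That the remaining parts of the rays are matched exactly, depth included, is what lets
  them survive infinitely many compositions.\<close>

definition bends :: "(real \<Rightarrow> real) \<Rightarrow> real set \<Rightarrow> real \<Rightarrow> (real \<times> real \<Rightarrow> real \<times> real) \<Rightarrow> bool" where
  "bends f Z \<epsilon> h \<longleftrightarrow> continuous_on UNIV h \<and> inj h \<and>
     (\<forall>x\<in>{0..1}. dist (h (x, 0)) (f x, 0) \<le> \<epsilon>) \<and>
     (\<forall>z\<in>Z. \<forall>t\<ge>\<epsilon>. h (z, - t) = (f z, - t)) \<and>
     (\<forall>z\<in>Z. \<forall>t\<in>{0..\<epsilon>}. dist (h (z, - t)) (f z, 0) \<le> \<epsilon>)"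

text \<open>The contribution of piecewise linearity: an interval containing a point with a larger value than
  both ends must contain a breakpoint, so the number of breakpoints can bound a recursion.\<close>

lemma piecewise_linear_breakpoints:
  assumes "piecewise_linear_map f"
  obtains E where "finite E" "0 \<in> E"
    "\<And>x y v. 0 \<le> x \<Longrightarrow> x < y \<Longrightarrow> y \<le> 1 \<Longrightarrow> {x<..<y} \<inter> E = {} \<Longrightarrow> v \<in> {x..y} \<Longrightarrow> f v \<le> max (f x) (f y)"
proof -
  obtain n and c :: "nat \<Rightarrow> real" where c: "c 0 = 0" "c n = 1"
    and lin: "\<And>i. i \<in> {1..n} \<Longrightarrow> \<exists>m b. \<forall>x\<in>{c (i - 1)..c i}. f x = m * x + b"
    using assms unfolding piecewise_linear_map_def by blast
  show ?thesis
  proof (rule that[of "c ` {..n}"])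
    show "0 \<in> c ` {..n}" using c(1) by (metis atMost_iff imageI le0)
    fix x y v :: real
    assume xy: "0 \<le> x" "x < y" "y \<le> 1" "{x<..<y} \<inter> c ` {..n} = {}" and v: "v \<in> {x..y}"
    define i where "i = (LEAST i. y \<le> c i)"
    have yi: "y \<le> c i" unfolding i_def by (rule LeastI[of _ n]) (use c xy in simp)
    have "i \<le> n" unfolding i_def by (rule Least_le) (use c xy in simp)
    have "i \<noteq> 0" using yi c(1) xy by auto
    then have "\<not> y \<le> c (i - 1)" using not_less_Least[of "i - 1" "\<lambda>i. y \<le> c i"] by (simp add: i_def)
    moreover have "c (i - 1) \<in> c ` {..n}" using \<open>i \<le> n\<close> by auto
    ultimately have "c (i - 1) \<le> x" using xy(4) by force
    obtain m b where mb: "\<And>x. x \<in> {c (i - 1)..c i} \<Longrightarrow> f x = m * x + b"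
      using lin[of i] \<open>i \<noteq> 0\<close> \<open>i \<le> n\<close> by force
    have "f v = m * v + b" "f x = m * x + b" "f y = m * y + b"
      using mb v xy(2) \<open>c (i - 1) \<le> x\<close> yi by auto
    moreover have "m * v \<le> max (m * x) (m * y)"
      using v by (cases "m \<ge> 0") (auto simp: mult_left_mono mult_left_mono_neg intro: max.coboundedI1 max.coboundedI2)
    ultimately show "f v \<le> max (f x) (f y)" by linarith
  qed simp
qed

text \<open>The existential quantifier over \<open>z\<close> in \<^const>\<open>removable\<close> is resolved by uniqueness: a visor belongs
  to the least marked point above it.\<close>

lemma visors_removable_unit_interval:
  assumes "\<And>v. visor f Z v \<Longrightarrow> removable f Z v"
  shows "visors_removable f Z True True 0 1"
  unfolding visors_removable_def
proof (intro ballI impI)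
  fix z v assume z: "z \<in> Z \<inter> {0..1}" and v: "v \<in> {0..<z}" "{v..<z} \<inter> Z = {}" "f z < f v"
  then have "visor_for f Z z v" by (auto simp: visor_for_def)
  then have "removable f Z v" using assms by (auto simp: visor_def)
  then obtain z' a b c where z': "visor_for f Z z' v" and abc: "a \<in> {0..1}" "c \<in> {0..1}" "removes f Z a b c z' v"
    unfolding removable_def by blast
  have "z' = z"
  proof (rule ccontr)
    assume "z' \<noteq> z"
    then have "z \<in> {v..<z'} \<or> z' \<in> {v..<z}"
      using z' v(1) by (cases z z' rule: linorder_cases) (auto simp: visor_for_def)
    then show False using z z' v(2) unfolding visor_for_def by blast
  qed
  show "\<exists>a b c. 0 \<le> a \<and> a < v \<and> v < b \<and> z < c \<and> c \<le> 1 \<and> {a<..<b} \<inter> Z = {} \<and>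
          ((True \<and> a = 0 \<and> 0 \<notin> Z) \<or> (\<forall>x\<in>{a..b}. f a \<le> f x)) \<and>
          ((True \<and> c = 1) \<or> (\<forall>x\<in>{a..b}. f x \<le> f c)) \<and> (\<forall>x\<in>{b..c}. f b \<le> f x)"
    using abc \<open>z' = z\<close> unfolding removes_def by (intro exI[of _ a] exI[of _ b] exI[of _ c]) simp
qed

text \<open>Let \<open>(\<sigma>, k)\<close> parametrize a layout and let \<open>m z\<close> be the parameter at which \<open>z\<close> is exposed. Over the
  compact set consisting of the graph of \<open>k\<close> and the vertical segments below the exposed points, the
  function \<open>f \<circ> \<sigma>\<close> of the first coordinate is isotone on horizontal slices; this is a reformulation
  of the two conditions on a layout. Hence it extends to a continuous family of
  nondecreasing maps of horizontal lines.\<close>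

lemma layout_sweep:
  assumes lay: "layout f Z True True 0 1" and contf: "continuous_on {0..1} f"
    and finZ: "finite Z" and Z01: "Z \<subseteq> {0..1}" and fZ: "strict_mono_on Z f"
  obtains \<sigma> k m \<Phi> where "continuous_on {0..1} \<sigma>" "continuous_on {0..1} k" "mono_on {0..1} \<sigma>"
    "\<sigma> 0 = 0" "\<sigma> 1 = (1::real)" "k ` {0..1} \<subseteq> {0..1::real}"
    "\<And>z. z \<in> Z \<Longrightarrow> m z \<in> {0..1::real}" "\<And>z. z \<in> Z \<Longrightarrow> \<sigma> (m z) = z"
    "continuous_on UNIV \<Phi>" "\<And>x x' w. x \<le> x' \<Longrightarrow> \<Phi> (x, w) \<le> \<Phi> (x', w)"
    "\<And>s. s \<in> {0..1} \<Longrightarrow> \<Phi> (s, k s) = f (\<sigma> s)"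
    "\<And>z w. z \<in> Z \<Longrightarrow> 0 \<le> w \<Longrightarrow> w \<le> k (m z) \<Longrightarrow> \<Phi> (m z, w) = f z"
proof -
  obtain \<Gamma> y y' where \<Gamma>: "rightward_path (0, y) \<Gamma> (1, y')" "\<Gamma> \<subseteq> UNIV \<times> {0..1}"
    "slicewise_mono f \<Gamma>" "\<And>z. z \<in> Z \<Longrightarrow> exposed_below f \<Gamma> z"
    using lay Z01 unfolding layout_def by blast
  obtain g where g: "path g" "path_image g = \<Gamma>" "pathstart g = (0, y)" "pathfinish g = (1, y')" "mono_on {0..1} (fst \<circ> g)"
    using \<Gamma>(1) unfolding rightward_path_def by blast
  define \<sigma> where "\<sigma> = fst \<circ> g"
  define k where "k = snd \<circ> g"
  have gk: "g s = (\<sigma> s, k s)" for s by (simp add: \<sigma>_def k_def)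
  have on: "(\<sigma> s, k s) \<in> \<Gamma>" if "s \<in> {0..1}" for s
    using g(2) that by (auto simp: path_image_def gk[symmetric])
  have cont\<sigma>: "continuous_on {0..1} \<sigma>" and contk: "continuous_on {0..1} k"
    using g(1) unfolding path_def \<sigma>_def k_def o_def by (auto intro: continuous_intros)
  have mono\<sigma>: "\<sigma> s \<le> \<sigma> s'" if "s \<in> {0..1}" "s' \<in> {0..1}" "s \<le> s'" for s s'
    using mono_onD[OF g(5)] that by (simp add: \<sigma>_def)
  have ends: "\<sigma> 0 = 0" "\<sigma> 1 = 1" using g(3,4) by (auto simp: \<sigma>_def pathstart_def pathfinish_def)
  have \<sigma>01: "\<sigma> s \<in> {0..1}" if "s \<in> {0..1}" for s
    using mono\<sigma>[of 0 s] mono\<sigma>[of s 1] ends that by auto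
  have k01: "k s \<in> {0..1}" if "s \<in> {0..1}" for s using on[OF that] \<Gamma>(2) by auto
  have "\<exists>s. s \<in> {0..1} \<and> \<sigma> s = z \<and> (\<forall>x y'. (x, y') \<in> \<Gamma> \<longrightarrow> y' \<le> k s \<longrightarrow> (x \<le> z \<longrightarrow> f x \<le> f z) \<and> (z \<le> x \<longrightarrow> f z \<le> f x))"
    if z: "z \<in> Z" for z
  proof -
    obtain y where y: "(z, y) \<in> \<Gamma>" "\<forall>x y'. (x, y') \<in> \<Gamma> \<longrightarrow> y' \<le> y \<longrightarrow> (x \<le> z \<longrightarrow> f x \<le> f z) \<and> (z \<le> x \<longrightarrow> f z \<le> f x)"
      using \<Gamma>(4)[OF z] unfolding exposed_below_def by blast
    then obtain s where s: "s \<in> {0..1}" "(z, y) = g s" using g(2) by (auto simp: path_image_def)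
    then have "\<sigma> s = z" "k s = y" by (simp_all add: gk)
    then show ?thesis using s y(2) by blast
  qed
  then obtain m where m: "\<And>z. z \<in> Z \<Longrightarrow> m z \<in> {0..1}" "\<And>z. z \<in> Z \<Longrightarrow> \<sigma> (m z) = z"
    and free: "\<And>z x y'. z \<in> Z \<Longrightarrow> (x, y') \<in> \<Gamma> \<Longrightarrow> y' \<le> k (m z) \<Longrightarrow> (x \<le> z \<longrightarrow> f x \<le> f z) \<and> (z \<le> x \<longrightarrow> f z \<le> f x)"
    by metis
  define F where "F = (\<lambda>s. (s, k s)) ` {0..1} \<union> (\<Union>z\<in>Z. {m z} \<times> {0..k (m z)})"
  have "compact F"
    unfolding F_def
    by (intro compact_Un compact_continuous_image compact_UN finZ continuous_intros contk compact_Times compact_Icc ballI) auto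
  have F01: "fst p \<in> {0..1}" if "p \<in> F" for p using that m(1) by (auto simp: F_def)
  have contu: "continuous_on F (\<lambda>p. f (\<sigma> (fst p)))"
  proof (rule continuous_on_compose2[OF contf])
    show "continuous_on F (\<lambda>p. \<sigma> (fst p))"
      by (rule continuous_on_compose2[OF cont\<sigma>]) (use F01 in \<open>auto intro!: continuous_intros\<close>)
  qed (use \<sigma>01 F01 in blast)
  have iso: "f (\<sigma> x) \<le> f (\<sigma> x')" if xF: "(x, w) \<in> F" "(x', w) \<in> F" "x \<le> x'" for x x' w
  proof -
    have x01: "x \<in> {0..1}" "x' \<in> {0..1}" using F01[OF xF(1)] F01[OF xF(2)] by simp_all
    have le: "\<sigma> x \<le> \<sigma> x'" using mono\<sigma> x01 xF(3) by blast
    have cases: "w = k x \<or> (\<exists>z\<in>Z. x = m z \<and> w \<le> k (m z))" if "(x, w) \<in> F" for x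
      using that by (auto simp: F_def)
    show ?thesis using cases[OF xF(1)] cases[OF xF(2)]
    proof (elim disjE bexE)
      assume "w = k x" "w = k x'"
      then show ?thesis using \<Gamma>(3) on x01 le unfolding slicewise_mono_def by metis
    next
      fix z assume "z \<in> Z" "x' = m z \<and> w \<le> k (m z)" "w = k x"
      then show ?thesis using free[of z "\<sigma> x" "k x"] on[OF x01(1)] m(2)[of z] le by auto
    next
      fix z assume "z \<in> Z" "x = m z \<and> w \<le> k (m z)" "w = k x'"
      then show ?thesis using free[of z "\<sigma> x'" "k x'"] on[OF x01(2)] m(2)[of z] le by auto
    next
      fix z z' assume "z \<in> Z" "x = m z \<and> w \<le> k (m z)" "z' \<in> Z" "x' = m z' \<and> w \<le> k (m z')"
      then show ?thesis using le m(2) strict_mono_onD[OF fZ, of z z'] by (cases "z = z'") auto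
    qed
  qed
  obtain \<Phi> where \<Phi>: "continuous_on UNIV \<Phi>" "\<And>p. p \<in> F \<Longrightarrow> \<Phi> p = f (\<sigma> (fst p))"
    "\<And>x x' w. x \<le> x' \<Longrightarrow> \<Phi> (x, w) \<le> \<Phi> (x', w)"
    using isotone_extension[OF \<open>compact F\<close> contu] iso by auto
  show ?thesis
  proof (rule that[of \<sigma> k m \<Phi>])
    show "\<Phi> (s, k s) = f (\<sigma> s)" if "s \<in> {0..1}" for s
      using \<Phi>(2)[of "(s, k s)"] that by (simp add: F_def)
    show "\<Phi> (m z, w) = f z" if "z \<in> Z" "0 \<le> w" "w \<le> k (m z)" for z w
    proof -
      have "(m z, w) \<in> F" using that by (auto simp: F_def)
      then show ?thesis using \<Phi>(2)[of "(m z, w)"] m(2) that by simp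
    qed
    show "mono_on {0..1} \<sigma>" using mono\<sigma> by (intro mono_onI)
    show "k ` {0..1} \<subseteq> {0..1}" using k01 by blast
  qed (use cont\<sigma> contk ends m \<Phi> in auto)
qed

lemma inverse_of_strict_mono_surj:
  fixes X :: "real \<Rightarrow> real"
  assumes "strict_mono X" "surj X"
  obtains \<tau> where "continuous_on UNIV \<tau>" "\<And>x. X (\<tau> x) = x" "\<And>s. \<tau> (X s) = s"
proof (rule that[of "inv X"])
  have i: "X (inv X x) = x" for x using assms(2) by (simp add: surj_f_inv_f)
  have "inj X" using assms(1) by (simp add: strict_mono_imp_inj_on)
  then show "inv X (X s) = s" for s by simp
  then have "range (inv X) = UNIV" by (metis surjI)
  then show "continuous_on UNIV (inv X)"
  proof (intro continuous_onI_mono)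
    fix x y :: real assume "x \<le> y"
    then have "X (inv X x) \<le> X (inv X y)" by (simp add: i)
    then show "inv X x \<le> inv X y" by (simp only: strict_mono_less_eq[OF assms(1)])
  qed simp
qed (use assms in \<open>simp add: surj_f_inv_f\<close>)

lemma dist_Pair_le: "dist (a, b) (c, d) \<le> \<bar>a - c\<bar> + \<bar>b - (d::real)\<bar>" for a c :: real
  by (simp add: dist_prod_def dist_real_def sqrt_sum_squares_le_sum_abs)

text \<open>The map is a composition of two fibrewise monotone maps. The first one preserves vertical lines (up
  to the change of parameter \<open>\<tau>\<close>) and lifts the point over \<open>x\<close> to the height \<open>\<delta> k (\<tau> x)\<close> given by the
  layout; it does not change heights below \<open>- \<epsilon>\<close>. The second one preserves horizontal lines and moves
  the lifted points to their horizontal position according to \<open>f\<close>. Strict monotonicity, hence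
  injectivity, is obtained from \<open>\<Phi>\<close> and \<open>\<sigma>\<close>, which are merely nondecreasing, by taking convex
  combinations of weight \<open>\<eta>\<close> with homeomorphisms \<open>\<rho>\<close> and \<open>\<theta>\<close> of the line. These have the right
  values at the exposed points already, so that the rays remain exactly vertical.\<close>

theorem bending_map:
  assumes pl: "piecewise_linear_map f" and finZ: "finite Z" and Z01: "Z \<subseteq> {0..1}"
    and fZ: "strict_mono_on Z f" and lay: "layout f Z True True 0 1" and "0 < \<epsilon>"
  shows "\<exists>h. bends f Z \<epsilon> h"
proof -
  have contf: "continuous_on {0..1} f" and f01: "f ` {0..1} \<subseteq> {0..1}"
    using pl unfolding piecewise_linear_map_def interval_map_def by auto
  obtain \<sigma> k m \<Phi> where cont\<sigma>: "continuous_on {0..1} \<sigma>" and contk: "continuous_on {0..1} k"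
    and mono\<sigma>: "mono_on {0..1} \<sigma>"
    and ends: "\<sigma> 0 = 0" "\<sigma> 1 = (1::real)" and k01: "k ` {0..1} \<subseteq> {0..1::real}"
    and m: "\<And>z. z \<in> Z \<Longrightarrow> m z \<in> {0..1::real}" "\<And>z. z \<in> Z \<Longrightarrow> \<sigma> (m z) = z"
    and \<Phi>: "continuous_on UNIV \<Phi>" "\<And>x x' w. x \<le> x' \<Longrightarrow> \<Phi> (x, w) \<le> \<Phi> (x', w)"
    "\<And>s. s \<in> {0..1} \<Longrightarrow> \<Phi> (s, k s) = f (\<sigma> s)"
    "\<And>z w. z \<in> Z \<Longrightarrow> 0 \<le> w \<Longrightarrow> w \<le> k (m z) \<Longrightarrow> \<Phi> (m z, w) = f z"
    by (rule layout_sweep[OF lay contf finZ Z01 fZ]) (rule that; assumption)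
  have \<sigma>le: "\<sigma> s \<le> \<sigma> s'" if "s \<in> {0..1}" "s' \<in> {0..1}" "s \<le> s'" for s s'
    using mono_onD[OF mono\<sigma>] that by blast
  have \<sigma>01: "\<sigma> s \<in> {0..1}" if "s \<in> {0..1}" for s
    using \<sigma>le[of 0 s] \<sigma>le[of s 1] ends that by auto
  have marks: "\<sigma> s < \<sigma> s'" if "s \<in> m ` Z" "s' \<in> m ` Z" "s < s'" for s s'
  proof -
    have "\<sigma> s \<le> \<sigma> s'" using \<sigma>le m(1) that by force
    moreover have "\<sigma> s \<noteq> \<sigma> s'" using that m(2) by auto
    ultimately show ?thesis by simp
  qed
  define S where "S = insert 0 (insert 1 (m ` Z))"
  \<comment> \<open>At an end of \<open>[0, 1]\<close> that is not the parameter of an exposed point, \<open>\<theta>\<close> overshoots. This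
    guarantees that \<open>\<tau>\<close> maps \<open>[0, 1]\<close> into \<open>[0, 1]\<close>, where the layout is defined.\<close>
  define u where "u = (\<lambda>s. if s \<in> m ` Z then \<sigma> s else if s = 0 then -1 else 2)"
  have mu: "strict_mono_on S u"
  proof (rule strict_mono_onI)
    fix r s assume rs: "r \<in> S" "s \<in> S" "r < s"
    have S01: "r \<in> {0..1}" "s \<in> {0..1}" using rs m(1) by (auto simp: S_def)
    then have "0 \<le> \<sigma> r" "\<sigma> r \<le> 1" "0 \<le> \<sigma> s" "\<sigma> s \<le> 1" using \<sigma>01 by force+
    moreover have "s \<in> m ` Z \<or> s = 1" "r \<in> m ` Z \<or> r = 0" using rs S01 by (auto simp: S_def)
    ultimately show "u r < u s" using marks[of r s] rs(3) by (auto simp: u_def)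
  qed
  have "finite S" using finZ by (simp add: S_def)
  then obtain \<theta> where l: "continuous_on UNIV \<theta>" "strict_mono \<theta>" "surj \<theta>" "\<And>s. s \<in> S \<Longrightarrow> \<theta> s = u s"
    using strict_mono_interpolation[OF \<open>finite S\<close> mu] by blast
  have f\<sigma>: "strict_mono_on (m ` Z) (\<lambda>s. f (\<sigma> s))"
  proof (rule strict_mono_onI)
    fix r s assume rs: "r \<in> m ` Z" "s \<in> m ` Z" "r < s"
    then have "\<sigma> r \<in> Z" "\<sigma> s \<in> Z" using m(2) by auto
    then show "f (\<sigma> r) < f (\<sigma> s)" using marks[OF rs] strict_mono_onD[OF fZ] by blast
  qed
  obtain \<rho> where r: "continuous_on UNIV \<rho>" "strict_mono \<rho>" "surj \<rho>" "\<And>s. s \<in> m ` Z \<Longrightarrow> \<rho> s = f (\<sigma> s)"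
    using strict_mono_interpolation[OF finite_imageI[OF finZ] f\<sigma>] by blast
  have \<rho>m: "\<rho> (m z) = f z" if "z \<in> Z" for z using r(4) m(2) that by auto
  have \<theta>m: "\<theta> (m z) = z" if "z \<in> Z" for z using l(4)[of "m z"] m(2) that by (auto simp: S_def u_def)
  have \<theta>ends: "\<theta> 0 \<in> {-1..0}" "\<theta> 1 \<in> {1..2}"
    using l(4)[of 0] l(4)[of 1] ends by (auto simp: S_def u_def split: if_splits)
  have \<theta>b: "\<theta> s \<in> {-1..2}" if "s \<in> {0..1}" for s
  proof -
    have "\<theta> 0 \<le> \<theta> s" "\<theta> s \<le> \<theta> 1" using that l(2) by (simp_all add: strict_mono_less_eq)
    then show ?thesis using \<theta>ends by simp
  qed
  define B where "B = max \<bar>\<rho> 0\<bar> \<bar>\<rho> 1\<bar>"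
  have \<rho>b: "\<bar>\<rho> s\<bar> \<le> B" if "s \<in> {0..1}" for s
  proof -
    have "\<rho> 0 \<le> \<rho> s" "\<rho> s \<le> \<rho> 1" using that r(2) by (simp_all add: strict_mono_less_eq)
    then show ?thesis by (auto simp: B_def)
  qed
  have "0 \<le> B" by (simp add: B_def)
  have "uniformly_continuous_on {0..1} f" using contf by (intro compact_uniformly_continuous) auto
  then obtain d where d: "d > 0" "\<And>x x'. x \<in> {0..1} \<Longrightarrow> x' \<in> {0..1} \<Longrightarrow> dist x' x < d \<Longrightarrow> dist (f x') (f x) < \<epsilon> / 4"
    using \<open>0 < \<epsilon>\<close> unfolding uniformly_continuous_on_def by (metis zero_less_divide_iff zero_less_numeral)
  define \<eta> where "\<eta> = min (1/2) (min (d / 4) (\<epsilon> / (4 * (1 + B))))"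
  have \<eta>: "0 < \<eta>" "\<eta> < 1" "2 * \<eta> < d" "\<eta> * (1 + B) \<le> \<epsilon> / 4"
  proof -
    show "0 < \<eta>" using d(1) \<open>0 < \<epsilon>\<close> \<open>0 \<le> B\<close> by (simp add: \<eta>_def)
    show "\<eta> < 1" by (auto simp: \<eta>_def)
    have "\<eta> \<le> d / 4" unfolding \<eta>_def by (rule min.coboundedI2, rule min.cobounded1)
    then show "2 * \<eta> < d" using d(1) by simp
    have "\<eta> \<le> \<epsilon> / (4 * (1 + B))" unfolding \<eta>_def by (rule min.coboundedI2, rule min.cobounded2)
    then show "\<eta> * (1 + B) \<le> \<epsilon> / 4" using \<open>0 \<le> B\<close> by (simp add: field_simps)
  qed
  define cl :: "real \<Rightarrow> real" where "cl s = max 0 (min 1 s)" for s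
  have cl01: "cl s \<in> {0..1}" for s by (auto simp: cl_def)
  have clid: "s \<in> {0..1} \<Longrightarrow> cl s = s" for s by (auto simp: cl_def)
  have clmono: "s \<le> s' \<Longrightarrow> cl s \<le> cl s'" for s s' by (auto simp: cl_def)
  have contcl: "continuous_on A cl" for A unfolding cl_def by (intro continuous_intros)
  define X where "X = (\<lambda>s. (1 - \<eta>) * \<sigma> (cl s) + \<eta> * \<theta> s)"
  have Xcont: "continuous_on UNIV X" unfolding X_def
    by (intro continuous_intros continuous_on_compose2[OF cont\<sigma> contcl] continuous_on_compose2[OF l(1)]) (use cl01 in auto)
  have Xmono: "strict_mono X"
  proof (rule strict_monoI)
    fix s s' :: real assume "s < s'"
    then have "\<sigma> (cl s) \<le> \<sigma> (cl s')" "\<theta> s < \<theta> s'" using \<sigma>le cl01 clmono l(2) by (auto simp: strict_mono_less)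
    then show "X s < X s'" unfolding X_def using \<eta> by (intro add_le_less_mono mult_left_mono mult_strict_left_mono) auto
  qed
  have "surj X" unfolding surj_def
  proof
    fix y
    obtain s1 s2 where s: "\<theta> s1 = (y - 1) / \<eta>" "\<theta> s2 = y / \<eta>" using l(3) by (metis surjD)
    have \<sigma>c: "0 \<le> \<sigma> (cl s)" "\<sigma> (cl s) \<le> 1" for s using \<sigma>01[OF cl01[of s]] by auto
    have "(1 - \<eta>) * \<sigma> (cl s1) \<le> 1" using \<sigma>c[of s1] \<eta> by (intro mult_le_one) auto
    moreover have "0 \<le> (1 - \<eta>) * \<sigma> (cl s2)" using \<sigma>c[of s2] \<eta> by (intro mult_nonneg_nonneg) auto
    ultimately have "X s1 \<le> y" "y \<le> X s2" using s \<eta>(1) by (auto simp: X_def)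
    moreover then have "s1 \<le> s2" using Xmono by (metis order_trans strict_mono_less_eq)
    ultimately obtain s where "X s = y" using IVT'[of X s1 y s2] continuous_on_subset[OF Xcont] by blast
    then show "\<exists>s. y = X s" by blast
  qed
  obtain \<tau> where \<tau>: "continuous_on UNIV \<tau>" "\<And>x. X (\<tau> x) = x" "\<And>s. \<tau> (X s) = s"
    by (rule inverse_of_strict_mono_surj[OF Xmono \<open>surj X\<close>]) (rule that; assumption)
  have \<tau>m: "\<tau> z = m z" if "z \<in> Z" for z
  proof -
    have "X (m z) = (1 - \<eta>) * z + \<eta> * z" using clid m \<theta>m that by (simp add: X_def)
    then have "X (m z) = z" by (simp add: algebra_simps)
    then show ?thesis using \<tau>(3) by metis
  qed
  have \<tau>01: "\<tau> x \<in> {0..1}" if "x \<in> {0..1}" for x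
  proof -
    have "X 0 \<le> 0" using \<theta>ends \<eta> ends by (simp add: X_def cl_def mult_nonneg_nonpos)
    moreover have "\<eta> * 1 \<le> \<eta> * \<theta> 1" using \<theta>ends \<eta>(1) by (intro mult_left_mono) auto
    then have "1 \<le> X 1" using ends by (simp add: X_def cl_def)
    ultimately have "X 0 \<le> X (\<tau> x)" "X (\<tau> x) \<le> X 1" using that by (auto simp: \<tau>(2))
    then show ?thesis using Xmono by (simp add: strict_mono_less_eq)
  qed
  define \<delta> where "\<delta> = \<epsilon> / 2"
  define \<psi> where "\<psi> = (\<lambda>x y. y + \<delta> * k (cl (\<tau> x)) * max 0 (1 - \<bar>y\<bar> / \<epsilon>))"
  define T where "T = (\<lambda>s w. (1 - \<eta>) * \<Phi> (s, cl (w / \<delta>)) + \<eta> * \<rho> s)"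
  define h where "h = (\<lambda>p. (T (\<tau> (fst p)) (\<psi> (fst p) (snd p)), \<psi> (fst p) (snd p)))"
  have "\<delta> > 0" using \<open>0 < \<epsilon>\<close> by (simp add: \<delta>_def)
  have kc: "0 \<le> k (cl s)" "k (cl s) \<le> 1" for s using k01 cl01[of s] by (auto simp: image_subset_iff)
  have cont\<psi>: "continuous_on UNIV (\<lambda>p. \<psi> (fst p) (snd p))"
    unfolding \<psi>_def
    by (intro continuous_intros continuous_on_compose2[OF contk] continuous_on_compose2[OF contcl] continuous_on_compose2[OF \<tau>(1)])
       (use cl01 \<open>0 < \<epsilon>\<close> in auto)
  have "continuous_on UNIV h"
    unfolding h_def T_def
    by (intro continuous_intros continuous_on_compose2[OF \<Phi>(1)] continuous_on_compose2[OF contcl]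
        continuous_on_compose2[OF r(1)] continuous_on_compose2[OF \<tau>(1)] cont\<psi>) (use \<open>\<delta> > 0\<close> in auto)
  have Tinj: "s = s'" if "T s w = T s' w" for s s' w
  proof -
    have "T s w < T s' w" if "s < s'" for s s'
      unfolding T_def using that \<eta> \<Phi>(2)[of s s'] r(2)
      by (intro add_le_less_mono mult_left_mono mult_strict_left_mono) (auto simp: strict_mono_less)
    then show ?thesis using \<open>T s w = T s' w\<close> by (metis less_irrefl linorder_less_linear)
  qed
  have \<psi>inj: "y = y'" if eq: "\<psi> x y = \<psi> x y'" for x y y'
  proof -
    let ?c = "\<delta> * k (cl (\<tau> x))"
    have c: "0 \<le> ?c" "?c \<le> \<delta>" using kc \<open>\<delta> > 0\<close> by (auto simp: mult_left_le)
    have "\<bar>max 0 (1 - \<bar>y\<bar> / \<epsilon>) - max 0 (1 - \<bar>y'\<bar> / \<epsilon>)\<bar> \<le> \<bar>\<bar>y\<bar> / \<epsilon> - \<bar>y'\<bar> / \<epsilon>\<bar>" by (auto simp: max_def)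
    also have "\<dots> = \<bar>\<bar>y\<bar> - \<bar>y'\<bar>\<bar> / \<epsilon>" using \<open>0 < \<epsilon>\<close> by (simp add: diff_divide_distrib[symmetric])
    also have "\<dots> \<le> \<bar>y - y'\<bar> / \<epsilon>" using \<open>0 < \<epsilon>\<close> by (intro divide_right_mono) auto
    finally have 1: "\<bar>max 0 (1 - \<bar>y\<bar> / \<epsilon>) - max 0 (1 - \<bar>y'\<bar> / \<epsilon>)\<bar> \<le> \<bar>y - y'\<bar> / \<epsilon>" .
    have "y' - y = ?c * (max 0 (1 - \<bar>y\<bar> / \<epsilon>) - max 0 (1 - \<bar>y'\<bar> / \<epsilon>))"
      using eq by (simp add: \<psi>_def algebra_simps)
    then have "\<bar>y' - y\<bar> = \<bar>?c\<bar> * \<bar>max 0 (1 - \<bar>y\<bar> / \<epsilon>) - max 0 (1 - \<bar>y'\<bar> / \<epsilon>)\<bar>"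
      by (simp only: abs_mult)
    then have "\<bar>y' - y\<bar> = ?c * \<bar>max 0 (1 - \<bar>y\<bar> / \<epsilon>) - max 0 (1 - \<bar>y'\<bar> / \<epsilon>)\<bar>"
      by (simp only: abs_of_nonneg[OF c(1)])
    also have "\<dots> \<le> \<delta> * (\<bar>y - y'\<bar> / \<epsilon>)" by (rule mult_mono[OF c(2) 1]) (use \<open>\<delta> > 0\<close> in auto)
    also have "\<dots> = \<bar>y - y'\<bar> / 2" using \<open>0 < \<epsilon>\<close> by (simp add: \<delta>_def)
    finally have "\<bar>y' - y\<bar> \<le> 0" by (simp add: abs_minus_commute)
    then show ?thesis by simp
  qed
  have "inj h"
  proof (rule injI)
    fix p q assume "h p = h q"
    then have eq: "(T (\<tau> (fst p)) (\<psi> (fst p) (snd p)), \<psi> (fst p) (snd p)) =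
        (T (\<tau> (fst q)) (\<psi> (fst q) (snd q)), \<psi> (fst q) (snd q))"
      by (simp only: h_def)
    have w: "\<psi> (fst p) (snd p) = \<psi> (fst q) (snd q)" using arg_cong[OF eq, of snd] by (simp only: snd_conv)
    have "T (\<tau> (fst p)) (\<psi> (fst p) (snd p)) = T (\<tau> (fst q)) (\<psi> (fst q) (snd q))"
      using arg_cong[OF eq, of fst] by (simp only: fst_conv)
    then have "\<tau> (fst p) = \<tau> (fst q)" unfolding w by (rule Tinj)
    then have "fst p = fst q" using \<tau>(2) by metis
    then show "p = q" using w \<psi>inj by (simp add: prod_eq_iff)
  qed
  have ray: "h (z, - t) = (f z, \<psi> z (- t))" if z: "z \<in> Z" and t: "0 \<le> t" for z t
  proof -
    have k0: "0 \<le> k (m z)" "k (m z) \<le> 1" using kc[of "m z"] clid[OF m(1)[OF z]] by simp_all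
    have "\<psi> z (- t) \<le> \<delta> * k (m z)"
    proof -
      have "\<delta> * k (m z) * max 0 (1 - \<bar>- t\<bar> / \<epsilon>) \<le> \<delta> * k (m z) * 1"
        using k0 \<open>\<delta> > 0\<close> \<open>0 < \<epsilon>\<close> by (intro mult_left_mono) auto
      then show ?thesis using t by (simp add: \<psi>_def \<tau>m[OF z] clid[OF m(1)[OF z]])
    qed
    then have "\<psi> z (- t) / \<delta> \<le> k (m z)" using \<open>\<delta> > 0\<close> by (simp add: field_simps)
    then have "0 \<le> cl (\<psi> z (- t) / \<delta>)" "cl (\<psi> z (- t) / \<delta>) \<le> k (m z)" using k0 by (auto simp: cl_def)
    then have "\<Phi> (m z, cl (\<psi> z (- t) / \<delta>)) = f z" using \<Phi>(4)[OF z] by blast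
    then show ?thesis using \<rho>m[OF z] by (simp add: h_def T_def \<tau>m[OF z] algebra_simps)
  qed
  show ?thesis unfolding bends_def
  proof (intro exI[of _ h] conjI ballI allI impI)
    show "continuous_on UNIV h" "inj h" by fact+
    show "h (z, - t) = (f z, - t)" if z: "z \<in> Z" and t: "\<epsilon> \<le> t" for z t
      using ray[OF z, of t] t \<open>0 < \<epsilon>\<close> by (simp add: \<psi>_def)
    show "dist (h (z, - t)) (f z, 0) \<le> \<epsilon>" if z: "z \<in> Z" and t': "t \<in> {0..\<epsilon>}" for z t
    proof -
      have t: "0 \<le> t" "t \<le> \<epsilon>" using t' by auto
      have w: "0 \<le> max 0 (1 - \<bar>- t\<bar> / \<epsilon>)" "max 0 (1 - \<bar>- t\<bar> / \<epsilon>) \<le> 1"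
        using t(1) \<open>0 < \<epsilon>\<close> by auto
      have "k (cl (\<tau> z)) * max 0 (1 - \<bar>- t\<bar> / \<epsilon>) \<le> 1 * 1"
        by (rule mult_mono) (use kc w in auto)
      moreover have "0 \<le> k (cl (\<tau> z)) * max 0 (1 - \<bar>- t\<bar> / \<epsilon>)" using kc w(1) by simp
      ultimately have "0 \<le> \<delta> * (k (cl (\<tau> z)) * max 0 (1 - \<bar>- t\<bar> / \<epsilon>))" "\<delta> * (k (cl (\<tau> z)) * max 0 (1 - \<bar>- t\<bar> / \<epsilon>)) \<le> \<delta> * 1"
        using \<open>\<delta> > 0\<close> by (auto intro!: mult_left_mono mult_nonneg_nonneg)
      moreover have "\<psi> z (- t) = - t + \<delta> * (k (cl (\<tau> z)) * max 0 (1 - \<bar>- t\<bar> / \<epsilon>))"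
        by (simp only: \<psi>_def mult.assoc)
      moreover have "\<delta> \<le> \<epsilon>" using \<open>0 < \<epsilon>\<close> by (simp add: \<delta>_def)
      ultimately have "\<bar>\<psi> z (- t)\<bar> \<le> \<epsilon>" using t by linarith
      then show ?thesis using ray[OF z t(1)] dist_Pair_le[of "f z" "\<psi> z (- t)" "f z" 0] by simp
    qed
    show "dist (h (x, 0)) (f x, 0) \<le> \<epsilon>" if x: "x \<in> {0..1}" for x
    proof -
      let ?s = "\<tau> x"
      have s: "?s \<in> {0..1}" using \<tau>01[OF x] .
      have k0: "0 \<le> k ?s" "k ?s \<le> 1" using kc[of ?s] clid[OF s] by simp_all
      have \<psi>0: "\<psi> x 0 = \<delta> * k ?s" by (simp add: \<psi>_def clid[OF s])
      then have "cl (\<psi> x 0 / \<delta>) = k ?s" using \<open>\<delta> > 0\<close> k0 by (simp add: clid)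
      then have hx: "h (x, 0) = ((1 - \<eta>) * f (\<sigma> ?s) + \<eta> * \<rho> ?s, \<delta> * k ?s)"
        using \<Phi>(3)[OF s] by (simp add: h_def T_def \<psi>0)
      have "x = (1 - \<eta>) * \<sigma> ?s + \<eta> * \<theta> ?s" using \<tau>(2)[of x] by (simp add: X_def clid[OF s])
      then have "\<sigma> ?s - x = \<eta> * (\<sigma> ?s - \<theta> ?s)" by (simp add: algebra_simps)
      then have "\<bar>\<sigma> ?s - x\<bar> = \<eta> * \<bar>\<sigma> ?s - \<theta> ?s\<bar>" using \<eta>(1) by (simp add: abs_mult)
      also have "\<dots> \<le> \<eta> * 2" using \<sigma>01[OF s] \<theta>b[OF s] \<eta>(1) by (intro mult_left_mono) auto
      also have "\<dots> < d" using \<eta>(3) by simp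
      finally have 1: "\<bar>f (\<sigma> ?s) - f x\<bar> < \<epsilon> / 4" using d(2)[OF x \<sigma>01[OF s]] by (simp add: dist_real_def)
      have "f (\<sigma> ?s) \<in> {0..1}" using f01 \<sigma>01[OF s] by blast
      then have "\<bar>\<rho> ?s - f (\<sigma> ?s)\<bar> \<le> 1 + B" using \<rho>b[OF s] by auto
      then have "\<eta> * \<bar>\<rho> ?s - f (\<sigma> ?s)\<bar> \<le> \<eta> * (1 + B)" using \<eta>(1) by (intro mult_left_mono) auto
      moreover have "\<bar>\<eta> * (\<rho> ?s - f (\<sigma> ?s))\<bar> = \<eta> * \<bar>\<rho> ?s - f (\<sigma> ?s)\<bar>"
        using \<eta>(1) by (simp add: abs_mult)
      ultimately have 2: "\<bar>\<eta> * (\<rho> ?s - f (\<sigma> ?s))\<bar> \<le> \<epsilon> / 4" using \<eta>(4) by linarith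
      have "(1 - \<eta>) * f (\<sigma> ?s) + \<eta> * \<rho> ?s - f x = (f (\<sigma> ?s) - f x) + \<eta> * (\<rho> ?s - f (\<sigma> ?s))"
        by (simp add: algebra_simps)
      then have 3: "\<bar>(1 - \<eta>) * f (\<sigma> ?s) + \<eta> * \<rho> ?s - f x\<bar> \<le> \<epsilon> / 2" using 1 2 by linarith
      have "\<bar>\<delta> * k ?s - 0\<bar> \<le> \<epsilon> / 2"
        using k0 \<open>\<delta> > 0\<close> by (simp add: abs_mult \<delta>_def mult_left_le)
      then show ?thesis unfolding hx using dist_Pair_le 3 by (smt (verit, best) field_sum_of_halves)
    qed
  qed
qed

section \<open>Embedding the inverse limit\<close>

lemma topspace_inverse_limit:
  "topspace (inverse_limit f) = {x \<in> {1..} \<rightarrow>\<^sub>E {0..1}. \<forall>i\<ge>1. f i (x (i + 1)) = x i}"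
  by (auto simp: inverse_limit_def)

lemma inverse_limit_coordinate:
  assumes "x \<in> topspace (inverse_limit f)" "1 \<le> i"
  shows "x i \<in> {0..1}" "f i (x (Suc i)) = x i"
  using assms by (auto simp: topspace_inverse_limit)

lemma continuous_map_inverse_limit_coordinate:
  assumes "1 \<le> i"
  shows "continuous_map (inverse_limit f) euclideanreal (\<lambda>x. x i)"
proof -
  have "continuous_map (product_topology (\<lambda>_. top_of_set {0..1}) {1..}) (top_of_set {0..1::real}) (\<lambda>x. x i)"
    using continuous_map_product_projection[of i "{1..}" "\<lambda>_. top_of_set {0..1}"] assms by auto
  then show ?thesis
    unfolding inverse_limit_def using continuous_map_from_subtopology continuous_map_into_fulltopology by blast
qed

lemma compact_space_inverse_limit:
  assumes "\<And>i. 1 \<le> i \<Longrightarrow> interval_map (f i)"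
  shows "compact_space (inverse_limit f)"
proof -
  let ?P = "product_topology (\<lambda>_::nat. top_of_set {0..1::real}) {1..}"
  have cP: "compact_space ?P"
    unfolding compact_space_product_topology by (simp add: compact_space_subtopology)
  have proj: "continuous_map ?P (top_of_set {0..1}) (\<lambda>x. x i)" if "1 \<le> i" for i
    using continuous_map_product_projection[of i "{1..}" "\<lambda>_. top_of_set {0..1}"] that by auto
  have "closedin ?P {x \<in> topspace ?P. f i (x (i + 1)) = x i}" if i: "1 \<le> i" for i
  proof (rule closedin_continuous_maps_eq)
    have fi: "continuous_map (top_of_set {0..1}) (top_of_set {0..1}) (f i)"
      using assms[OF i] by (auto simp: interval_map_def)
    show "continuous_map ?P (top_of_set {0..1}) (\<lambda>x. f i (x (i + 1)))"
      using continuous_map_compose[OF proj[of "i + 1"] fi] by (simp add: o_def)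
    show "continuous_map ?P (top_of_set {0..1}) (\<lambda>x. x i)" by (rule proj[OF i])
    show "Hausdorff_space (top_of_set {0..1::real})" by (simp add: Hausdorff_space_subtopology)
  qed
  then have "closedin ?P (\<Inter>i\<in>{1..}. {x \<in> topspace ?P. f i (x (i + 1)) = x i})"
    by (intro closedin_Inter) auto
  moreover have "(\<Inter>i\<in>{1..}. {x \<in> topspace ?P. f i (x (i + 1)) = x i}) = topspace ?P \<inter> {x. \<forall>i\<ge>1. f i (x (i + 1)) = x i}"
    by auto
  ultimately have "compactin ?P (topspace ?P \<inter> {x. \<forall>i\<ge>1. f i (x (i + 1)) = x i})"
    using closedin_compact_space[OF cP] by simp
  then have "compact_space (subtopology ?P (topspace ?P \<inter> {x. \<forall>i\<ge>1. f i (x (i + 1)) = x i}))"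
    unfolding compactin_subspace by blast
  then show ?thesis unfolding inverse_limit_def subtopology_restrict .
qed

text \<open>Closeness of a single late coordinate controls all earlier ones. This is what will make the limit
  map injective: two points of the limit with the same image have, at each level, coordinates that are
  close in this sense.\<close>

lemma inverse_limit_modulus:
  assumes maps: "\<And>i. 1 \<le> i \<Longrightarrow> interval_map (f i)"
  shows "\<And>e. 0 < e \<Longrightarrow> \<exists>d>0. \<forall>x\<in>topspace (inverse_limit f). \<forall>y\<in>topspace (inverse_limit f).
    \<bar>x (Suc n) - y (Suc n)\<bar> \<le> d \<longrightarrow> (\<forall>m\<in>{1..Suc n}. \<bar>x m - y m\<bar> \<le> e)"
proof (induction n)
  case 0
  have "{1..Suc 0} = {Suc 0}" by auto
  then show ?case using 0 by (intro exI[of _ e]) auto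
next
  case (Suc n)
  let ?X = "topspace (inverse_limit f)"
  obtain d where d: "d > 0" "\<And>x y m. x \<in> ?X \<Longrightarrow> y \<in> ?X \<Longrightarrow> \<bar>x (Suc n) - y (Suc n)\<bar> \<le> d \<Longrightarrow> m \<in> {1..Suc n} \<Longrightarrow> \<bar>x m - y m\<bar> \<le> e"
    using Suc.IH[OF Suc.prems] by blast
  have "continuous_on {0..1} (f (Suc n))" using maps[of "Suc n"] by (simp add: interval_map_def)
  then have "uniformly_continuous_on {0..1} (f (Suc n))" by (intro compact_uniformly_continuous) auto
  then obtain d' where d': "d' > 0" "\<And>a b. a \<in> {0..1} \<Longrightarrow> b \<in> {0..1} \<Longrightarrow> dist b a < d' \<Longrightarrow> dist (f (Suc n) b) (f (Suc n) a) < d"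
    using d(1) unfolding uniformly_continuous_on_def by metis
  show ?case
  proof (intro exI[of _ "min (d' / 2) e"] conjI ballI impI)
    show "0 < min (d' / 2) e" using d' Suc.prems by simp
    fix x y m assume x: "x \<in> ?X" and y: "y \<in> ?X" and xy: "\<bar>x (Suc (Suc n)) - y (Suc (Suc n))\<bar> \<le> min (d' / 2) e"
      and m: "m \<in> {1..Suc (Suc n)}"
    show "\<bar>x m - y m\<bar> \<le> e"
    proof (cases "m = Suc (Suc n)")
      case False
      have "dist (x (Suc (Suc n))) (y (Suc (Suc n))) < d'" using xy d'(1) by (auto simp: dist_real_def)
      then have "dist (f (Suc n) (x (Suc (Suc n)))) (f (Suc n) (y (Suc (Suc n)))) < d"
        using d'(2) inverse_limit_coordinate(1)[OF x, of "Suc (Suc n)"] inverse_limit_coordinate(1)[OF y, of "Suc (Suc n)"] by auto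
      then have "\<bar>x (Suc n) - y (Suc n)\<bar> \<le> d"
        using inverse_limit_coordinate(2)[OF x, of "Suc n"] inverse_limit_coordinate(2)[OF y, of "Suc n"] by (simp add: dist_real_def)
      then show ?thesis using d(2)[OF x y] m False by auto
    qed (use xy in simp)
  qed
qed

lemma uniform_near_unit_interval:
  fixes G :: "real \<times> real \<Rightarrow> 'a::metric_space"
  assumes "continuous_on UNIV G" "0 < e"
  obtains d where "d > 0" "\<And>x p. x \<in> {0..1} \<Longrightarrow> dist p (x, 0) \<le> d \<Longrightarrow> dist (G p) (G (x, 0)) \<le> e"
proof -
  have "uniformly_continuous_on (cball 0 2) G"
    using assms(1) by (intro compact_uniformly_continuous) (auto intro: continuous_on_subset)
  then obtain d where d: "d > 0" "\<And>p q. p \<in> cball 0 2 \<Longrightarrow> q \<in> cball 0 2 \<Longrightarrow> dist q p < d \<Longrightarrow> dist (G q) (G p) < e"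
    using assms(2) unfolding uniformly_continuous_on_def by metis
  show ?thesis
  proof (rule that[of "min 1 (d / 2)"])
    show "0 < min 1 (d / 2)" using d by simp
    fix x :: real and p :: "real \<times> real" assume x: "x \<in> {0..1}" and p: "dist p (x, 0) \<le> min 1 (d / 2)"
    have "norm (x, 0::real) \<le> 1" using x by (simp add: norm_Pair)
    moreover have "norm p \<le> dist p (x, 0) + norm (x, 0::real)"
      by (metis dist_norm norm_triangle_sub add.commute)
    moreover have "dist p (x, 0) \<le> 1" using p by simp
    ultimately have "(x, 0::real) \<in> cball 0 2" "p \<in> cball 0 2" unfolding mem_cball_0 by linarith+
    moreover have "dist p (x, 0) < d" using p d(1) by simp
    ultimately show "dist (G p) (G (x, 0)) \<le> e" using d(2) by (meson less_imp_le)
  qed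
qed

lemma plane_vector_embedding:
  obtains \<iota> :: "real \<times> real \<Rightarrow> real^2" where "continuous_on UNIV \<iota>" "inj \<iota>"
proof (rule that[of "\<lambda>p. \<chi> i. if i = 1 then fst p else snd p"])
  show "continuous_on UNIV (\<lambda>p. (\<chi> i. if i = 1 then fst p else snd p) :: real^2)"
  proof (rule continuous_on_vec_lambda)
    fix i :: 2
    show "continuous_on UNIV (\<lambda>p. if i = 1 then fst p else (snd p :: real))"
      by (cases "i = 1") (auto intro: continuous_intros)
  qed
  show "inj (\<lambda>p. (\<chi> i. if i = 1 then fst p else snd p) :: real^2)"
    by (rule injI) (auto simp: vec_eq_iff forall_2 prod_eq_iff)
qed

text \<open>The levels are numbered from 0 here, while the coordinates of the inverse limit start at 1. The map
  \<open>H n\<close> draws the interval of level \<open>Suc n\<close> in the plane; \<open>\<delta> n\<close> is the radius of a neighbourhood of that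
  interval. Each \<open>h n\<close> is chosen after \<open>\<delta> n\<close>, so that the next interval is bent inside the current
  neighbourhood, and \<open>\<delta> (Suc n)\<close> is chosen after \<open>h n\<close>.\<close>

lemma nested_bending_sequence:
  assumes maps: "\<And>i. 1 \<le> i \<Longrightarrow> interval_map (f i)"
    and bend: "\<And>i \<epsilon>. 1 \<le> i \<Longrightarrow> 0 < \<epsilon> \<Longrightarrow> \<exists>h. bends (f i) (Z i) \<epsilon> h"
    and \<rho>: "\<And>n. 0 < (\<rho> n :: real)"
  obtains H :: "nat \<Rightarrow> real \<times> real \<Rightarrow> real^2" and h :: "nat \<Rightarrow> real \<times> real \<Rightarrow> real \<times> real" and \<delta> :: "nat \<Rightarrow> real"
  where "\<And>n. continuous_on UNIV (H n)" "\<And>n. inj (H n)" "\<And>n. 0 < \<delta> n" "\<And>n. \<delta> n \<le> 1 / Suc n" "\<And>n. \<delta> n \<le> \<rho> n"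
    "\<And>n x p. x \<in> {0..1} \<Longrightarrow> dist p (x, 0) \<le> \<delta> n \<Longrightarrow> dist (H n p) (H n (x, 0)) \<le> 1 / Suc n"
    "\<And>n. \<delta> (Suc n) \<le> \<delta> n" "\<And>n p. H (Suc n) p = H n (h n p)"
    "\<And>n x p. x \<in> {0..1} \<Longrightarrow> dist p (x, 0) \<le> \<delta> (Suc n) \<Longrightarrow> dist (h n p) (f (Suc n) x, 0) \<le> \<delta> n"
    "\<And>n z t. z \<in> Z (Suc n) \<Longrightarrow> \<delta> n \<le> t \<Longrightarrow> h n (z, - t) = (f (Suc n) z, - t)"
    "\<And>n z t. z \<in> Z (Suc n) \<Longrightarrow> 0 \<le> t \<Longrightarrow> t \<le> \<delta> n \<Longrightarrow> dist (h n (z, - t)) (f (Suc n) z, 0) \<le> \<delta> n"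
proof -
  define P where "P = (\<lambda>n (H :: real \<times> real \<Rightarrow> real^2, d). continuous_on UNIV H \<and> inj H \<and> 0 < d \<and> d \<le> 1 / Suc n \<and> d \<le> \<rho> n \<and>
    (\<forall>x\<in>{0..1}. \<forall>p. dist p (x, 0) \<le> d \<longrightarrow> dist (H p) (H (x, 0)) \<le> 1 / Suc n))"
  define R where "R = (\<lambda>n d h d'. (\<forall>x\<in>{0..1}. \<forall>p. dist p (x, 0::real) \<le> d' \<longrightarrow> dist (h p) (f (Suc n) x, 0::real) \<le> (d::real)) \<and>
      (\<forall>z\<in>Z (Suc n). \<forall>t\<ge>d. h (z, - t) = (f (Suc n) z, - t)) \<and>
      (\<forall>z\<in>Z (Suc n). \<forall>t\<in>{0..d}. dist (h (z, - t)) (f (Suc n) z, 0) \<le> d))"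
  define Q where "Q = (\<lambda>n (H :: real \<times> real \<Rightarrow> real^2, d) (H', d'). d' \<le> d \<and> (\<exists>h. H' = H \<circ> h \<and> R n d h d'))"
  have shrink: "\<exists>d. P n (H, d) \<and> d \<le> D" if Hc: "continuous_on UNIV H" "inj H" "0 < D" for n H D
  proof -
    obtain d where d: "d > 0" "\<And>x p. x \<in> {0..1} \<Longrightarrow> dist p (x, 0) \<le> d \<Longrightarrow> dist (H p) (H (x, 0)) \<le> 1 / Suc n"
      by (rule uniform_near_unit_interval[OF Hc(1), of "1 / Suc n"]) (simp, rule that, assumption+)
    show ?thesis
      by (rule exI[of _ "min (min d D) (min (1 / Suc n) (\<rho> n))"]) (use Hc d \<rho>[of n] in \<open>auto simp: P_def\<close>)
  qed
  have step: "\<exists>y. P (Suc n) y \<and> Q n x y" if "P n x" for n x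
  proof -
    obtain H d where x: "x = (H, d)" by force
    have Hd: "continuous_on UNIV H" "inj H" "0 < d" using that by (auto simp: x P_def)
    obtain h where h: "bends (f (Suc n)) (Z (Suc n)) (d / 2) h" using bend[of "Suc n" "d / 2"] Hd(3) by auto
    then have hc: "continuous_on UNIV h" "inj h" by (auto simp: bends_def)
    obtain e where e: "e > 0" "\<And>x p. x \<in> {0..1} \<Longrightarrow> dist p (x, 0) \<le> e \<Longrightarrow> dist (h p) (h (x, 0)) \<le> d / 2"
      by (rule uniform_near_unit_interval[OF hc(1), of "d / 2"]) (use Hd(3) in simp, rule that, assumption+)
    have "continuous_on UNIV (H \<circ> h)" using hc Hd continuous_on_compose continuous_on_subset by (metis top_greatest)
    moreover have "inj (H \<circ> h)" using hc Hd by (simp add: inj_compose)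
    ultimately obtain d' where d': "P (Suc n) (H \<circ> h, d')" "d' \<le> min d e"
      using shrink[of "H \<circ> h" "min d e" "Suc n"] Hd(3) e(1) by auto
    have "R n d h d'" unfolding R_def
    proof (intro conjI ballI allI impI)
      fix x :: real and p :: "real \<times> real" assume x: "x \<in> {0..1}" and p: "dist p (x, 0) \<le> d'"
      have "dist (h p) (h (x, 0)) \<le> d / 2" using e(2)[OF x] p d'(2) by simp
      moreover have "dist (h (x, 0)) (f (Suc n) x, 0) \<le> d / 2" using h x by (auto simp: bends_def)
      ultimately show "dist (h p) (f (Suc n) x, 0) \<le> d"
        using dist_triangle[of "h p" "(f (Suc n) x, 0)" "h (x, 0)"] by linarith
    next
      fix z t assume "z \<in> Z (Suc n)" "d \<le> t"
      then show "h (z, - t) = (f (Suc n) z, - t)" using h Hd(3) by (auto simp: bends_def)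
    next
      fix z t assume z: "z \<in> Z (Suc n)" and t: "t \<in> {0..d}"
      show "dist (h (z, - t)) (f (Suc n) z, 0) \<le> d"
      proof (cases "t \<le> d / 2")
        case True
        then have "dist (h (z, - t)) (f (Suc n) z, 0) \<le> d / 2" using h z t by (auto simp: bends_def)
        then show ?thesis using Hd(3) by simp
      next
        case False
        then have "h (z, - t) = (f (Suc n) z, - t)" using h z by (auto simp: bends_def)
        then show ?thesis using t by (simp add: dist_Pair_Pair dist_real_def)
      qed
    qed
    then have "Q n x (H \<circ> h, d')" using d'(2) by (auto simp: Q_def x)
    then show ?thesis using d'(1) by blast
  qed
  have start: "\<exists>x. P 0 x"
  proof -
    obtain \<iota> :: "real \<times> real \<Rightarrow> real^2" where \<iota>: "continuous_on UNIV \<iota>" "inj \<iota>" by (rule plane_vector_embedding)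
    then show ?thesis using shrink[OF \<iota>, of 1 0] by auto
  qed
  obtain s where s: "\<And>n. P n (s n)" "\<And>n. Q n (s n) (s (Suc n))"
    using dependent_nat_choice[of P Q, OF start step] by blast
  have s2: "s n = (fst (s n), snd (s n))" for n by simp
  have "\<exists>h. fst (s (Suc n)) = fst (s n) \<circ> h \<and> R n (snd (s n)) h (snd (s (Suc n)))" for n
    using s(2)[of n] by (auto simp: Q_def split: prod.splits)
  then obtain h where h: "\<And>n. fst (s (Suc n)) = fst (s n) \<circ> h n" "\<And>n. R n (snd (s n)) (h n) (snd (s (Suc n)))"
    by metis
  have Ps: "continuous_on UNIV (fst (s n)) \<and> inj (fst (s n)) \<and> 0 < snd (s n) \<and> snd (s n) \<le> 1 / Suc n \<and> snd (s n) \<le> \<rho> n \<and>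
    (\<forall>x\<in>{0..1}. \<forall>p. dist p (x, 0) \<le> snd (s n) \<longrightarrow> dist (fst (s n) p) (fst (s n) (x, 0)) \<le> 1 / Suc n)" for n
    using s(1)[of n] by (auto simp: P_def split: prod.splits)
  show ?thesis
  proof (rule that[of "\<lambda>n. fst (s n)" "\<lambda>n. snd (s n)" h])
    show "snd (s (Suc n)) \<le> snd (s n)" for n
      using s(2)[of n] by (auto simp: Q_def split: prod.splits)
    show "fst (s (Suc n)) p = fst (s n) (h n p)" for n p by (simp add: h(1))
  qed (use Ps h(2) in \<open>auto simp: R_def\<close>)
qed

text \<open>A point \<open>x\<close> of the inverse limit is sent to the only point common to the images under \<open>H n\<close> of the
  disks of radius \<open>\<delta> n\<close> around \<open>(x (Suc n), 0)\<close>; these images decrease because bending respects the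
  neighbourhoods. The access path to the image of \<open>c\<close> at time \<open>t > 0\<close> is the image under \<open>H n\<close> of the point
  at depth \<open>t\<close> below \<open>c (Suc n)\<close>, for any \<open>n\<close> with \<open>\<delta> n \<le> t\<close>: the choice of \<open>n\<close> is immaterial because later
  bendings fix the ray at this depth. As that point lies outside the neighbourhood of radius \<open>\<delta> n\<close>
  if \<open>\<delta> n < t\<close>, it is not in the image of the inverse limit.\<close>

theorem inverse_limit_embedding:
  assumes maps: "\<And>i. 1 \<le> i \<Longrightarrow> interval_map (f i)"
    and bend: "\<And>i \<epsilon>. 1 \<le> i \<Longrightarrow> 0 < \<epsilon> \<Longrightarrow> \<exists>h. bends (f i) (Z i) \<epsilon> h"
  obtains \<Omega> :: "(nat \<Rightarrow> real) \<Rightarrow> real^2" where "embedding_map (inverse_limit f) euclidean \<Omega>"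
    "\<And>c j. c \<in> topspace (inverse_limit f) \<Longrightarrow> (\<And>i. j \<le> i \<Longrightarrow> c (Suc i) \<in> Z i) \<Longrightarrow>
      accessible (\<Omega> ` topspace (inverse_limit f)) (\<Omega> c)"
proof -
  define X where "X = topspace (inverse_limit f)"
  have "\<exists>d>0. \<forall>x\<in>X. \<forall>y\<in>X. \<bar>x (Suc n) - y (Suc n)\<bar> \<le> d \<longrightarrow> (\<forall>m\<in>{1..Suc n}. \<bar>x m - y m\<bar> \<le> 1 / Suc n)" for n
    using inverse_limit_modulus[OF maps, where e = "1 / Suc n" and n = n] unfolding X_def by simp
  then obtain r where r0: "\<And>n. 0 < r n"
    and r: "\<And>n x y m. x \<in> X \<Longrightarrow> y \<in> X \<Longrightarrow> \<bar>x (Suc n) - y (Suc n)\<bar> \<le> r n \<Longrightarrow> m \<in> {1..Suc n} \<Longrightarrow> \<bar>x m - y m\<bar> \<le> 1 / Suc n"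
    by metis
  obtain H :: "nat \<Rightarrow> real \<times> real \<Rightarrow> real^2" and h and \<delta>
    where contH: "\<And>n. continuous_on UNIV (H n)" and injH: "\<And>n. inj (H n)"
    and \<delta>0: "\<And>n. 0 < \<delta> n" and \<delta>n: "\<And>n. \<delta> n \<le> 1 / Suc n" and \<delta>r: "\<And>n. \<delta> n \<le> r n / 2"
    and small: "\<And>n x p. x \<in> {0..1} \<Longrightarrow> dist p (x, 0) \<le> \<delta> n \<Longrightarrow> dist (H n p) (H n (x, 0)) \<le> 1 / Suc n"
    and \<delta>Suc: "\<And>n. \<delta> (Suc n) \<le> \<delta> n" and HSuc: "\<And>n p. H (Suc n) p = H n (h n p)"
    and near: "\<And>n x p. x \<in> {0..1} \<Longrightarrow> dist p (x, 0) \<le> \<delta> (Suc n) \<Longrightarrow> dist (h n p) (f (Suc n) x, 0) \<le> \<delta> n"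
    and ray: "\<And>n z t. z \<in> Z (Suc n) \<Longrightarrow> \<delta> n \<le> t \<Longrightarrow> h n (z, - t) = (f (Suc n) z, - t)"
    and tip: "\<And>n z t. z \<in> Z (Suc n) \<Longrightarrow> 0 \<le> t \<Longrightarrow> t \<le> \<delta> n \<Longrightarrow> dist (h n (z, - t)) (f (Suc n) z, 0) \<le> \<delta> n"
    by (rule nested_bending_sequence[where f = f and Z = Z and \<rho> = "\<lambda>n. r n / 2"])
       (erule maps, erule bend, assumption, use r0 in simp, rule that, assumption+)
  have coord: "x (Suc n) \<in> {0..1}" "f (Suc n) (x (Suc (Suc n))) = x (Suc n)" if "x \<in> X" for x n
    using inverse_limit_coordinate[of x f "Suc n"] that by (auto simp: X_def)
  define D where "D = (\<lambda>x n. H n ` cball (x (Suc n), 0) (\<delta> n))"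
  have nest: "D x (Suc n) \<subseteq> D x n" if "x \<in> X" for x n
  proof
    fix q assume "q \<in> D x (Suc n)"
    then obtain p where p: "dist p (x (Suc (Suc n)), 0) \<le> \<delta> (Suc n)" "q = H (Suc n) p"
      by (auto simp: D_def dist_commute)
    have "dist (h n p) (x (Suc n), 0) \<le> \<delta> n" using near[OF coord(1)[OF that] p(1)] coord(2)[OF that] by simp
    then show "q \<in> D x n" using p(2) by (auto simp: D_def HSuc dist_commute)
  qed
  have ne: "\<Inter> (range (D x)) \<noteq> {}" if "x \<in> X" for x
  proof (rule compact_nest)
    show "compact (D x n)" for n unfolding D_def
      by (intro compact_continuous_image continuous_on_subset[OF contH]) auto
    show "D x n \<noteq> {}" for n using \<delta>0[of n] by (auto simp: D_def)
    show "D x n \<subseteq> D x m" if "m \<le> n" for m n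
      by (rule lift_Suc_antimono_le[of "D x", OF nest[OF \<open>x \<in> X\<close>] that])
  qed
  have "\<exists>q. \<forall>n. q \<in> D x n" if "x \<in> X" for x using ne[OF that] by auto
  then obtain \<Omega> where \<Omega>: "\<And>x n. x \<in> X \<Longrightarrow> \<Omega> x \<in> D x n" by metis
  have close: "dist q (H n (x (Suc n), 0)) \<le> 1 / Suc n" if "q \<in> D x n" "x \<in> X" for q x n
    using that small[OF coord(1)[OF that(2)]] by (auto simp: D_def dist_commute)
  have inv_to_0: "\<exists>n\<ge>k. 1 / Suc n < e" if e: "0 < e" for e :: real and k
  proof -
    obtain n where "1 / Suc n < e" using nat_approx_posE[OF e] by blast
    moreover have "1 / real (Suc (max k n)) \<le> 1 / real (Suc n)" by (intro divide_left_mono) auto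
    ultimately show ?thesis by (intro exI[of _ "max k n"]) auto
  qed
  have cont\<Omega>: "continuous_map (inverse_limit f) euclidean \<Omega>"
  proof -
    have "continuous_map (inverse_limit f) Met_TC.mtopology \<Omega>"
    proof (rule Met_TC.continuous_map_uniform_limit[where F = sequentially and f = "\<lambda>n x. H n (x (Suc n), 0)"])
      show "\<forall>\<^sub>F n in sequentially. continuous_map (inverse_limit f) Met_TC.mtopology (\<lambda>x. H n (x (Suc n), 0))"
      proof (intro always_eventually allI)
        fix n
        have g: "continuous_map euclideanreal euclidean (\<lambda>a. H n (a, 0))"
          by (simp, intro continuous_on_compose2[OF contH] continuous_intros) auto
        show "continuous_map (inverse_limit f) Met_TC.mtopology (\<lambda>x. H n (x (Suc n), 0))"
          using continuous_map_compose[OF continuous_map_inverse_limit_coordinate[of "Suc n" f] g] by (simp add: o_def)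
      qed
      show "\<forall>\<^sub>F n in sequentially. \<forall>x\<in>topspace (inverse_limit f). \<Omega> x \<in> UNIV \<and> dist (H n (x (Suc n), 0)) (\<Omega> x) < e"
        if e: "0 < e" for e
      proof -
        obtain N where N: "1 / Suc N < e" using inv_to_0[OF e] by blast
        show ?thesis unfolding eventually_sequentially
        proof (intro exI[of _ N] allI impI ballI conjI UNIV_I)
          fix n x assume "N \<le> n" and x: "x \<in> topspace (inverse_limit f)"
          then have "dist (H n (x (Suc n), 0)) (\<Omega> x) \<le> 1 / Suc n"
            using close[OF \<Omega>, of x n] by (simp add: X_def dist_commute)
          also have "\<dots> \<le> 1 / Suc N" using \<open>N \<le> n\<close> by (intro divide_left_mono) auto
          finally show "dist (H n (x (Suc n), 0)) (\<Omega> x) < e" using N by simp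
        qed
      qed
    qed simp
    then show ?thesis by simp
  qed
  have inj\<Omega>: "inj_on \<Omega> X"
  proof (rule inj_onI)
    fix x y assume x: "x \<in> X" and y: "y \<in> X" and eq: "\<Omega> x = \<Omega> y"
    have near: "\<bar>x (Suc n) - y (Suc n)\<bar> \<le> r n" for n
    proof -
      obtain p q where p: "dist (x (Suc n), 0) p \<le> \<delta> n" "\<Omega> x = H n p" and q: "dist (y (Suc n), 0) q \<le> \<delta> n" "\<Omega> y = H n q"
        using \<Omega>[OF x, of n] \<Omega>[OF y, of n] by (auto simp: D_def)
      have "p = q" using injH[of n] p q eq by (auto dest: injD)
      then have "dist (x (Suc n), 0::real) (y (Suc n), 0) \<le> 2 * \<delta> n"
        using dist_triangle2[of "(x (Suc n), 0)" "(y (Suc n), 0)" p] p(1) q(1) by simp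
      then show ?thesis using \<delta>r[of n] by (simp add: dist_Pair_Pair dist_real_def)
    qed
    have "x m = y m" if "1 \<le> m" for m
    proof (rule ccontr)
      assume "x m \<noteq> y m"
      then obtain n where n: "n \<ge> m" "1 / Suc n < \<bar>x m - y m\<bar>" using inv_to_0[of "\<bar>x m - y m\<bar>" m] by auto
      then show False using r[OF x y near[of n], of m] that by auto
    qed
    moreover have "x \<in> {1..} \<rightarrow>\<^sub>E {0..1}" "y \<in> {1..} \<rightarrow>\<^sub>E {0..1}" using x y by (auto simp: X_def topspace_inverse_limit)
    ultimately show "x = y" by (intro PiE_ext[of x "{1..}" "\<lambda>_. {0..1}" y]) auto
  qed
  have embedding: "embedding_map (inverse_limit f) euclidean \<Omega>"
  proof (rule injective_closed_imp_embedding_map[OF cont\<Omega>])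
    show "closed_map (inverse_limit f) euclidean \<Omega>"
      by (rule continuous_imp_closed_map_gen[OF compact_space_inverse_limit[OF maps] _ cont\<Omega>])
         (auto intro: Hausdorff_imp_kc_space)
    show "inj_on \<Omega> (topspace (inverse_limit f))" using inj\<Omega> by (simp add: X_def)
  qed
  have access: "accessible (\<Omega> ` X) (\<Omega> c)" if c: "c \<in> X" and cZ: "\<And>i. j \<le> i \<Longrightarrow> c (Suc i) \<in> Z i" for c j
  proof -
    define R where "R = (\<lambda>n t. H n (c (Suc n), - t))"
    have \<delta>mono: "\<delta> n' \<le> \<delta> n" if "n \<le> n'" for n n'
      by (rule lift_Suc_antimono_le[of \<delta>, OF \<delta>Suc that])
    have R1: "R (Suc n) t = R n t" if "j \<le> Suc n" "\<delta> n \<le> t" for n t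
      using ray[OF cZ[OF that(1)] that(2)] coord(2)[OF c] by (simp add: R_def HSuc)
    have R2: "R (n + k) t = R n t" if "j \<le> n" "\<delta> n \<le> t" for n k t
    proof (induction k)
      case (Suc k)
      have "\<delta> (n + k) \<le> t" using \<delta>mono[of n "n + k"] that by simp
      then show ?case using R1[of "n + k" t] Suc that by simp
    qed simp
    have R3: "R n t = R n' t" if "j \<le> n" "\<delta> n \<le> t" "j \<le> n'" "\<delta> n' \<le> t" for n n' t
      using R2[of n t "n' - n"] R2[of n' t "n - n'"] that by (cases "n \<le> n'") auto
    have RD: "R (n + k) t \<in> D c n" if "j \<le> n" "0 \<le> t" "t \<le> \<delta> n" for n k t
      using that
    proof (induction k arbitrary: n)
      case 0
      then have "dist (c (Suc n), 0) (c (Suc n), - t) \<le> \<delta> n" by (simp add: dist_Pair_Pair dist_real_def)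
      then show ?case by (auto simp: R_def D_def)
    next
      case (Suc k)
      show ?case
      proof (cases "t \<le> \<delta> (Suc n)")
        case True
        then have "R (Suc n + k) t \<in> D c (Suc n)" using Suc.IH[of "Suc n"] Suc.prems by simp
        then show ?thesis using nest[OF c, of n] by auto
      next
        case False
        then have "R (n + Suc k) t = R (Suc n) t" using R2[of "Suc n" t k] Suc.prems by simp
        moreover have "dist (h n (c (Suc (Suc n)), - t)) (c (Suc n), 0) \<le> \<delta> n"
          using tip[of "c (Suc (Suc n))" n t] cZ[of "Suc n"] coord(2)[OF c, of n] Suc.prems by simp
        ultimately show ?thesis by (auto simp: R_def D_def HSuc dist_commute)
      qed
    qed
    have ex: "\<exists>n\<ge>max j k. \<delta> n < t" if "0 < t" for t k
      using inv_to_0[OF that, of "max j k"] \<delta>n by (meson le_less_trans)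
    define N where "N = (\<lambda>t. SOME n. j \<le> n \<and> \<delta> n \<le> t)"
    have N: "j \<le> N t" "\<delta> (N t) \<le> t" if "0 < t" for t
    proof -
      have "\<exists>n. j \<le> n \<and> \<delta> n \<le> t" using ex[OF that, of 0] by force
      then have "j \<le> N t \<and> \<delta> (N t) \<le> t" unfolding N_def by (rule someI_ex)
      then show "j \<le> N t" "\<delta> (N t) \<le> t" by auto
    qed
    define P where "P = (\<lambda>t. if t \<le> 0 then \<Omega> c else R (N t) t)"
    have PR: "P t = R n t" if "j \<le> n" "\<delta> n \<le> t" for n t
    proof -
      have "0 < t" using that \<delta>0[of n] by linarith
      then show ?thesis using R3[of "N t" t n] N that by (simp add: P_def)
    qed
    have PD: "P t \<in> D c n" if "j \<le> n" "t \<le> \<delta> n" for n t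
    proof (cases "t \<le> 0")
      case True
      then show ?thesis using \<Omega>[OF c] by (simp add: P_def)
    next
      case False
      then obtain n' where n': "n' \<ge> max j n" "\<delta> n' < t" using ex[of t n] by auto
      then have "P t = R (n + (n' - n)) t" using PR[of n' t] by simp
      then show ?thesis using RD[of n t "n' - n"] that False by simp
    qed
    have Pout: "P t \<notin> \<Omega> ` X" if t: "0 < t" for t
    proof
      assume "P t \<in> \<Omega> ` X"
      then obtain x where x: "x \<in> X" "P t = \<Omega> x" by auto
      obtain n where n: "j \<le> n" "\<delta> n < t" using ex[OF t, of 0] by auto
      have "H n (c (Suc n), - t) \<in> D x n" using PR[of n t] n x \<Omega>[of x n] by (simp add: R_def)
      then obtain p where p: "dist (x (Suc n), 0) p \<le> \<delta> n" "H n (c (Suc n), - t) = H n p" by (auto simp: D_def)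
      then have "p = (c (Suc n), - t)" using injH[of n] by (auto dest: injD)
      then have "dist 0 (- t) \<le> \<delta> n" using p(1) dist_snd_le[of "(x (Suc n), 0)" p] by simp
      then show False using n(2) t by (simp add: dist_real_def)
    qed
    have contP: "continuous_on {0..1} P"
    proof (rule continuous_at_imp_continuous_on, intro ballI)
      fix t :: real assume "t \<in> {0..1}"
      show "isCont P t"
      proof (cases "t = 0")
        case True
        show ?thesis unfolding True continuous_at_eps_delta
        proof (intro allI impI)
          fix e :: real assume "0 < e"
          then obtain n where n: "n \<ge> j" "1 / Suc n < e / 2" using inv_to_0[of "e / 2" j] by auto
          show "\<exists>d>0. \<forall>t'. dist t' 0 < d \<longrightarrow> dist (P t') (P 0) < e"
          proof (intro exI[of _ "\<delta> n"] conjI allI impI \<delta>0)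
            fix t' :: real assume "dist t' 0 < \<delta> n"
            then have "P t' \<in> D c n" "P 0 \<in> D c n" using PD[OF n(1), of t'] PD[OF n(1), of 0] \<delta>0[of n] by (auto simp: dist_real_def)
            then have "dist (P t') (H n (c (Suc n), 0)) \<le> 1 / Suc n" "dist (P 0) (H n (c (Suc n), 0)) \<le> 1 / Suc n"
              using close c by blast+
            then show "dist (P t') (P 0) < e" using dist_triangle2[of "P t'" "P 0" "H n (c (Suc n), 0)"] n(2) by linarith
          qed
        qed
      next
        case False
        then have "0 < t" using \<open>t \<in> {0..1}\<close> by simp
        then obtain n where n: "j \<le> n" "\<delta> n < t" using ex[of t 0] by auto
        have "continuous_on {\<delta> n<..} (R n)" unfolding R_def
          by (intro continuous_on_compose2[OF contH] continuous_intros) auto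
        then have "continuous_on {\<delta> n<..} P"
          by (rule continuous_on_eq) (use PR n in auto)
        then show ?thesis using n(2) by (simp add: continuous_on_eq_continuous_at)
      qed
    qed
    have "P 0 = \<Omega> c" by (simp add: P_def)
    have "P 1 \<noteq> P 0" using Pout[of 1] c \<open>P 0 = \<Omega> c\<close> by auto
    then obtain q where q: "arc q" "path_image q \<subseteq> path_image P" "pathstart q = P 0" "pathfinish q = P 1"
      using path_contains_arc[of P "P 0" "P 1"] contP by (auto simp: path_def pathstart_def pathfinish_def)
    have "path_image q \<inter> \<Omega> ` X = {\<Omega> c}"
    proof
      show "{\<Omega> c} \<subseteq> path_image q \<inter> \<Omega> ` X"
        using q(3) c \<open>P 0 = \<Omega> c\<close> pathstart_in_path_image[of q] by auto
      show "path_image q \<inter> \<Omega> ` X \<subseteq> {\<Omega> c}"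
      proof
        fix w assume w: "w \<in> path_image q \<inter> \<Omega> ` X"
        then obtain t where t: "t \<in> {0..1}" "w = P t" using q(2) by (auto simp: path_image_def)
        then have "\<not> 0 < t" using Pout[of t] w by auto
        then show "w \<in> {\<Omega> c}" using t \<open>P 0 = \<Omega> c\<close> by auto
      qed
    qed
    then show ?thesis using q(1) c unfolding accessible_def by auto
  qed
  show ?thesis
    using that[OF embedding] access unfolding X_def by blast
qed

theorem proposition7:
  fixes f :: "nat \<Rightarrow> real \<Rightarrow> real"
    and X :: "(nat \<Rightarrow> real) topology"
    and Z :: "(nat \<Rightarrow> real) set"
    and z :: "nat \<Rightarrow> nat \<Rightarrow> real"
  assumes "\<And>i. i \<ge> 1 \<Longrightarrow> piecewise_linear_map (f i)"
    and "X = inverse_limit f"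
    and "Z \<subseteq> topspace X" and "countable Z" and "infinite Z"
    and "Z = z ` {1..}"
    and "\<And>i. i \<ge> 1 \<Longrightarrow> inj_on (\<lambda>k. z k (i + 1)) {1..i}"
    and "\<And>i. i \<ge> 1 \<Longrightarrow> strict_mono_on ((\<lambda>k. z k (i + 1)) ` {1..i}) (f i)"
    and "\<And>i v. i \<ge> 1 \<Longrightarrow> visor (f i) ((\<lambda>k. z k (i + 1)) ` {1..i}) v \<Longrightarrow>
           removable (f i) ((\<lambda>k. z k (i + 1)) ` {1..i}) v"
  shows "\<exists>\<Omega> :: (nat \<Rightarrow> real) \<Rightarrow> real^2.
           embedding_map X euclidean \<Omega> \<and>
           (\<forall>w\<in>Z. accessible (\<Omega> ` topspace X) (\<Omega> w))"
proof -
  define S where "S = (\<lambda>i. (\<lambda>k. z k (i + 1)) ` {1..i})"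
  have zX: "z k \<in> topspace (inverse_limit f)" if "1 \<le> k" for k
    using assms(2,3,6) that by auto
  have maps: "interval_map (f i)" if "1 \<le> i" for i
    using assms(1)[OF that] by (simp add: piecewise_linear_map_def)
  have bend: "\<exists>h. bends (f i) (S i) \<epsilon> h" if i: "1 \<le> i" and \<epsilon>: "0 < \<epsilon>" for i \<epsilon>
  proof -
    have contf: "continuous_on {0..1} (f i)" using maps[OF i] by (simp add: interval_map_def)
    have fin: "finite (S i)" by (simp add: S_def)
    have S01: "S i \<subseteq> {0..1}"
      using inverse_limit_coordinate(1)[OF zX, of _ "i + 1"] by (auto simp: S_def)
    have mono: "strict_mono_on (S i) (f i)" using assms(8)[OF i] by (simp add: S_def)
    have removable: "visors_removable (f i) (S i) True True 0 1"
      by (rule visors_removable_unit_interval) (use assms(9)[OF i] in \<open>simp add: S_def\<close>)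
    obtain E where E: "finite E" "0 \<in> E"
      "\<And>x y v. 0 \<le> x \<Longrightarrow> x < y \<Longrightarrow> y \<le> 1 \<Longrightarrow> {x<..<y} \<inter> E = {} \<Longrightarrow> v \<in> {x..y} \<Longrightarrow> f i v \<le> max (f i x) (f i y)"
      by (rule piecewise_linear_breakpoints[OF assms(1)[OF i]]) (rule that, assumption+)
    have "layout (f i) (S i) True True 0 1"
      by (rule layout_exists[OF contf fin mono E(1) E(3)]) (use removable E(2) in simp_all)
    then show ?thesis by (rule bending_map[OF assms(1)[OF i] fin S01 mono _ \<epsilon>])
  qed
  obtain \<Omega> :: "(nat \<Rightarrow> real) \<Rightarrow> real^2" where \<Omega>: "embedding_map (inverse_limit f) euclidean \<Omega>"
    "\<And>c j. c \<in> topspace (inverse_limit f) \<Longrightarrow> (\<And>i. j \<le> i \<Longrightarrow> c (Suc i) \<in> S i) \<Longrightarrow>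
      accessible (\<Omega> ` topspace (inverse_limit f)) (\<Omega> c)"
    by (rule inverse_limit_embedding[OF maps bend]) (assumption, assumption, assumption, rule that, assumption, blast)
  have "accessible (\<Omega> ` topspace (inverse_limit f)) (\<Omega> (z j))" if j: "1 \<le> j" for j
  proof (rule \<Omega>(2)[OF zX[OF j], of j])
    show "z j (Suc i) \<in> S i" if "j \<le> i" for i using j that by (auto simp: S_def)
  qed
  then show ?thesis
    using \<Omega>(1) assms(2,6) by (intro exI[of _ \<Omega>]) auto
qed

end
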